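(* Let $G$ be an infinite countable discrete amenable group and let $(X,G)$ be a $G$-system with positive topological entropy. Then $(X,G)$ is Li-Yorke chaotic.
   Context: A $G$-system $(X,G)$ consists of a compact metric space $X$ (with metric $\rho$) on which the countable discrete group $G$ acts by self-homeomorphisms, $x\mapsto gx$. $G$ is amenable if there is a sequence $\{F_n\}$ of nonempty finite subsets of $G$ (a Følner sequence) with $|gF_n\Delta F_n|/|F_n|\to 0$ for every $g\in G$. For a finite open cover $\mathcal U$ of $X$ and a nonempty finite $F\subset G$, let $\mathcal U_F=\bigvee_{g\in F}g^{-1}\mathcal U$ and let $N(\mathcal U_F,X)$ be the minimal cardinality of a subfamily of $\mathcal U_F$ covering $X$. The topological entropy is $$h_{\mathrm{top}}(G,X)=\sup_{\mathcal U}\lim_{n\to\infty}\frac1{|F_n|}\log N(\mathcal U_{F_n},X),$$ the supremum being over all finite open covers of $X$ (the limit exists and does not depend on the Følner sequence). A pair $(x_1,x_2)\in X^2$ is a Li-Yorke pair if $$\limsup_{G\ni g\to\infty}\rho(gx_1,gx_2)>0\quad\text{and}\quad \liminf_{G\ni g\to\infty}\rho(gx_1,gx_2)=0,$$ where the limsup and liminf are the limits of $\sup_{g\in G\setminus F}\rho(gx_1,gx_2)$ and $\inf_{g\in G\setminus F}\rho(gx_1,gx_2)$, respectively, over the net of nonempty finite subsets $F\subset G$ ordered by inclusion. $(X,G)$ is Li-Yorke chaotic if there is an uncountable $Z\subset X$ such that every pair $(x_1,x_2)\in Z^2$ with $x_1\neq x_2$ is a Li-Yorke pair. *)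

theory Defs
  imports "HOL-Analysis.Analysis" "HOL-Algebra.Group_Action"
begin

text \<open>The compact metric space is a compact subset \<open>X\<close> of an ambient metric-space type, with the
  metric \<open>dist\<close>; \<open>\<phi> g x\<close> stands for \<open>gx\<close>.  As a permutation in \<open>BijGroup X\<close>, the map \<open>\<phi> g\<close> is
  \<open>undefined\<close> off \<open>X\<close>.\<close>

locale G_system = group_action G X \<phi>
  for G (structure) and X :: "'x::metric_space set" and \<phi> +
  assumes countable_group: "countable (carrier G)"
    and compact_space: "compact X"
    and homeo: "\<And>g. g \<in> carrier G \<Longrightarrow> \<exists>h. homeomorphism X X (\<phi> g) h"

definition folner_sequence :: "('g, 'm) monoid_scheme \<Rightarrow> (nat \<Rightarrow> 'g set) \<Rightarrow> bool" where
  "folner_sequence G F \<longleftrightarrow>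
     (\<forall>n. finite (F n) \<and> F n \<noteq> {} \<and> F n \<subseteq> carrier G) \<and>
     (\<forall>g\<in>carrier G.
        (\<lambda>n. real (card (sym_diff (g <#\<^bsub>G\<^esub> F n) (F n))) / real (card (F n))) \<longlonglongrightarrow> 0)"

definition amenable :: "('g, 'm) monoid_scheme \<Rightarrow> bool" where
  "amenable G \<longleftrightarrow> (\<exists>F. folner_sequence G F)"

definition finite_open_cover :: "'x::topological_space set \<Rightarrow> 'x set set \<Rightarrow> bool" where
  "finite_open_cover X \<U> \<longleftrightarrow>
     finite \<U> \<and> (\<forall>U\<in>\<U>. openin (top_of_set X) U) \<and> \<Union>\<U> = X"

text \<open>The join of the covers \<open>g\<^sup>-\<^sup>1\<U>\<close> over \<open>g \<in> F\<close>: a member is an intersection of sets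
  \<open>g\<^sup>-\<^sup>1(s g)\<close> for a choice \<open>s\<close> of an element of \<open>\<U>\<close> for each \<open>g \<in> F\<close>.\<close>

definition cover_join ::
  "'x set \<Rightarrow> ('g \<Rightarrow> 'x \<Rightarrow> 'x) \<Rightarrow> 'x set set \<Rightarrow> 'g set \<Rightarrow> 'x set set" where
  "cover_join X \<phi> \<U> F = {{x \<in> X. \<forall>g\<in>F. \<phi> g x \<in> s g} |s. s \<in> F \<rightarrow> \<U>}"

definition min_subcover_card :: "'x set set \<Rightarrow> 'x set \<Rightarrow> nat" where
  "min_subcover_card \<V> X = (LEAST k. \<exists>\<W>\<subseteq>\<V>. finite \<W> \<and> X \<subseteq> \<Union>\<W> \<and> card \<W> = k)"

text \<open>The entropy is extended-real-valued, as the supremum may be infinite.  The Folner sequence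
  is an argument: for a \<open>G\<close>-system the limit exists and is the same for all Folner sequences.\<close>

definition topological_entropy ::
  "'x::metric_space set \<Rightarrow> ('g \<Rightarrow> 'x \<Rightarrow> 'x) \<Rightarrow> (nat \<Rightarrow> 'g set) \<Rightarrow> ereal" where
  "topological_entropy X \<phi> F =
     (SUP \<U>\<in>{\<U>. finite_open_cover X \<U>}.
        ereal (lim (\<lambda>n. ln (real (min_subcover_card (cover_join X \<phi> \<U> (F n)) X))
                        / real (card (F n)))))"

text \<open>Upper and lower limits as the group element tends to infinity: \<open>finite_subsets_at_top\<close> is
  the net of finite subsets ordered by inclusion.  The real-valued \<open>SUP\<close> and \<open>INF\<close> are meaningful
  when the group is infinite and \<open>f\<close> is bounded.\<close>

definition limsup_infinity :: "('g, 'm) monoid_scheme \<Rightarrow> ('g \<Rightarrow> real) \<Rightarrow> real" where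
  "limsup_infinity G f =
     Lim (finite_subsets_at_top (carrier G)) (\<lambda>F. SUP g\<in>carrier G - F. f g)"

definition liminf_infinity :: "('g, 'm) monoid_scheme \<Rightarrow> ('g \<Rightarrow> real) \<Rightarrow> real" where
  "liminf_infinity G f =
     Lim (finite_subsets_at_top (carrier G)) (\<lambda>F. INF g\<in>carrier G - F. f g)"

definition li_yorke_pair ::
  "('g, 'm) monoid_scheme \<Rightarrow> ('g \<Rightarrow> 'x::metric_space \<Rightarrow> 'x) \<Rightarrow> 'x \<Rightarrow> 'x \<Rightarrow> bool" where
  "li_yorke_pair G \<phi> x\<^sub>1 x\<^sub>2 \<longleftrightarrow>
     limsup_infinity G (\<lambda>g. dist (\<phi> g x\<^sub>1) (\<phi> g x\<^sub>2)) > 0 \<and>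
     liminf_infinity G (\<lambda>g. dist (\<phi> g x\<^sub>1) (\<phi> g x\<^sub>2)) = 0"

definition li_yorke_chaotic ::
  "('g, 'm) monoid_scheme \<Rightarrow> 'x::metric_space set \<Rightarrow> ('g \<Rightarrow> 'x \<Rightarrow> 'x) \<Rightarrow> bool" where
  "li_yorke_chaotic G X \<phi> \<longleftrightarrow>
     (\<exists>Z\<subseteq>X. uncountable Z \<and>
        (\<forall>x\<^sub>1\<in>Z. \<forall>x\<^sub>2\<in>Z. x\<^sub>1 \<noteq> x\<^sub>2 \<longrightarrow> li_yorke_pair G \<phi> x\<^sub>1 x\<^sub>2))"

end

theory Submission
  imports Defs
begin

text \<open>A tuple \<open>(A\<^sub>i)\<close> of disjoint closed sets has positive density if, for infinitely many \<open>n\<close>, there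
  is \<open>J \<subseteq> F n\<close> with \<open>|J| \<ge> c |F n|\<close> such that for every choice \<open>\<sigma>\<close> some \<open>x\<close> satisfies
  \<open>gx \<in> A (\<sigma> g)\<close> for all \<open>g \<in> J\<close>.  By a Sauer-Shelah argument this is equivalent to exponential
  growth of the cover \<open>(X - A\<^sub>i)\<close>, and growth is inherited by one factor of a join.  Hence positive
  entropy yields a pair of positive density, and a member of a tuple may be shrunk to a small set.
  As \<open>F n\<close> is almost invariant, \<open>J\<close> and \<open>g\<^sup>-\<^sup>1J\<close> overlap in positive density for some \<open>g\<close> outside
  any given finite set, so that the tuple of all \<open>A\<^sub>i \<inter> g\<^sup>-\<^sup>1A\<^sub>j\<close> has positive density again.  Iterating
  these moves builds a Cantor set any two points of which are brought close together and are
  separated by group elements arbitrarily far out.\<close>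


subsection \<open>Patterns, covers and shattering\<close>

text \<open>If each \<open>C z\<close> covers \<open>Y\<close>, this bounds the covering number of
  the join of the covers \<open>C z\<close>. Only \<open>card \<Phi> \<le> k\<close> is asked, so
  minimal covers need not be singled out; a lower bound on the covering number is stated as a bound
  for all \<open>k\<close>.\<close>

definition pattern_cover :: "'y set \<Rightarrow> 'z set \<Rightarrow> ('z \<Rightarrow> 'i \<Rightarrow> 'y set) \<Rightarrow> 'i set \<Rightarrow> nat \<Rightarrow> bool" where
  "pattern_cover Y Z C I k \<longleftrightarrow>
     (\<exists>\<Phi>. finite \<Phi> \<and> card \<Phi> \<le> k \<and> \<Phi> \<subseteq> Z \<rightarrow> I \<and> (\<forall>y\<in>Y. \<exists>p\<in>\<Phi>. \<forall>z\<in>Z. y \<in> C z (p z)))"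

text \<open>With two indices this is shattering in the sense of Vapnik and Chervonenkis; for
  pulled-back sets \<open>A z\<close>, dynamics calls \<open>W\<close> an independence set of the
  tuple.\<close>

definition shatters :: "'y set \<Rightarrow> 'z set \<Rightarrow> ('z \<Rightarrow> 'i \<Rightarrow> 'y set) \<Rightarrow> 'i set \<Rightarrow> bool" where
  "shatters Y W A I \<longleftrightarrow> (\<forall>\<sigma>\<in>W \<rightarrow> I. \<exists>y\<in>Y. \<forall>z\<in>W. y \<in> A z (\<sigma> z))"

lemma shatters_mono: "shatters Y W A I \<Longrightarrow> Y \<subseteq> Y' \<Longrightarrow> shatters Y' W A I"
  unfolding shatters_def by blast

lemma shattersD: "shatters Y W A I \<Longrightarrow> \<sigma> \<in> W \<rightarrow> I \<Longrightarrow> \<exists>y\<in>Y. \<forall>z\<in>W. y \<in> A z (\<sigma> z)"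
  unfolding shatters_def by blast

lemma shatters_insert:
  assumes "\<And>i. i \<in> I \<Longrightarrow> shatters (Y \<inter> A z i) W A I"
  shows "shatters Y (insert z W) A I"
  unfolding shatters_def
proof
  fix \<sigma> assume \<sigma>: "\<sigma> \<in> insert z W \<rightarrow> I"
  then have "shatters (Y \<inter> A z (\<sigma> z)) W A I" using assms by auto
  moreover have "\<sigma> \<in> W \<rightarrow> I" using \<sigma> by auto
  ultimately obtain y where "y \<in> Y \<inter> A z (\<sigma> z)" "\<forall>w\<in>W. y \<in> A w (\<sigma> w)"
    unfolding shatters_def by blast
  then show "\<exists>y\<in>Y. \<forall>w\<in>insert z W. y \<in> A w (\<sigma> w)" by auto
qed

lemma pattern_cover_empty: "pattern_cover {} Z C I 0"
  unfolding pattern_cover_def by (rule exI[of _ "{}"]) auto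

lemma pattern_cover_Un:
  assumes "pattern_cover Y Z C I k" "pattern_cover Y' Z C I k'"
  shows "pattern_cover (Y \<union> Y') Z C I (k + k')"
proof -
  obtain \<Phi> \<Psi> where *: "finite \<Phi>" "card \<Phi> \<le> k" "\<Phi> \<subseteq> Z \<rightarrow> I"
    "\<forall>y\<in>Y. \<exists>p\<in>\<Phi>. \<forall>z\<in>Z. y \<in> C z (p z)"
    "finite \<Psi>" "card \<Psi> \<le> k'" "\<Psi> \<subseteq> Z \<rightarrow> I"
    "\<forall>y\<in>Y'. \<exists>p\<in>\<Psi>. \<forall>z\<in>Z. y \<in> C z (p z)"
    using assms unfolding pattern_cover_def by metis
  moreover have "card (\<Phi> \<union> \<Psi>) \<le> k + k'"
    using card_Un_le[of \<Phi> \<Psi>] * by linarith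
  ultimately show ?thesis unfolding pattern_cover_def
    by (intro exI[of _ "\<Phi> \<union> \<Psi>"]) blast
qed

text \<open>A coordinate at which one set already contains \<open>Y\<close> receives the constant
  letter \<open>i\<close>, so it costs no new patterns.\<close>

lemma pattern_cover_insert:
  assumes "pattern_cover Y Z C I k" "z \<notin> Z" "i \<in> I" "Y \<subseteq> C z i"
  shows "pattern_cover Y (insert z Z) C I k"
proof -
  obtain \<Phi> where *: "finite \<Phi>" "card \<Phi> \<le> k" "\<Phi> \<subseteq> Z \<rightarrow> I"
    "\<forall>y\<in>Y. \<exists>p\<in>\<Phi>. \<forall>z\<in>Z. y \<in> C z (p z)"
    using assms unfolding pattern_cover_def by metis
  let ?\<Psi> = "(\<lambda>p. p(z := i)) ` \<Phi>"
  have "card ?\<Psi> \<le> k" using card_image_le[OF *(1)] *(2) by (meson le_trans)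
  moreover have "?\<Psi> \<subseteq> insert z Z \<rightarrow> I" using *(3) assms(2,3) by fastforce
  moreover have "\<exists>q\<in>?\<Psi>. \<forall>w\<in>insert z Z. y \<in> C w (q w)" if y: "y \<in> Y" for y
  proof -
    obtain p where "p \<in> \<Phi>" "\<forall>w\<in>Z. y \<in> C w (p w)"
      using bspec[OF *(4) y] by (elim bexE)
    then show ?thesis using assms(2,4) y by (intro bexI[of _ "p(z := i)"]) auto
  qed
  ultimately show ?thesis unfolding pattern_cover_def
    using *(1) by (intro exI[of _ ?\<Psi>] conjI ballI finite_imageI)
qed

section \<open>Counting shattered sets: a Sauer-Shelah argument\<close>

text \<open>Count incidences by elements: each element of the union lies in at most
  \<open>card I - 1\<close> of the sets, and in one more only if it lies in all of them.\<close>

lemma sum_card_le_UN_INT: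
  fixes S :: "'i \<Rightarrow> 'a set"
  assumes "finite I" "I \<noteq> {}" "\<And>i. i \<in> I \<Longrightarrow> finite (S i)"
  shows "(\<Sum>i\<in>I. card (S i)) \<le> (card I - 1) * card (\<Union>i\<in>I. S i) + card (\<Inter>i\<in>I. S i)"
proof -
  let ?U = "\<Union>i\<in>I. S i" and ?V = "\<Inter>i\<in>I. S i"
  have fU: "finite ?U" using assms by auto
  have VU: "?V \<subseteq> ?U" using assms by auto
  have "(\<Sum>i\<in>I. card (S i)) = (\<Sum>i\<in>I. \<Sum>w\<in>?U. if w \<in> S i then 1 else 0)"
  proof (rule sum.cong[OF refl])
    fix i assume "i \<in> I"
    then have "?U \<inter> S i = S i" by auto
    then show "card (S i) = (\<Sum>w\<in>?U. if w \<in> S i then 1 else 0)"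
      by (simp add: sum.inter_restrict[OF fU, symmetric])
  qed
  also have "\<dots> = (\<Sum>w\<in>?U. \<Sum>i\<in>I. if w \<in> S i then 1 else 0)" by (rule sum.swap)
  also have "\<dots> \<le> (\<Sum>w\<in>?U. (card I - 1) + (if w \<in> ?V then 1 else 0))"
  proof (rule sum_mono)
    fix w
    have eq: "(\<Sum>i\<in>I. if w \<in> S i then 1 else 0) = card {i\<in>I. w \<in> S i}"
      using sum.inter_filter[OF assms(1), of "\<lambda>_. 1::nat" "\<lambda>i. w \<in> S i"] by simp
    show "(\<Sum>i\<in>I. if w \<in> S i then 1 else 0) \<le> (card I - 1) + (if w \<in> ?V then 1 else 0)"
    proof (cases "w \<in> ?V")
      case True
      have "card {i\<in>I. w \<in> S i} \<le> card I" by (rule card_mono) (use assms in auto)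
      then show ?thesis using True unfolding eq by auto
    next
      case False
      then have "{i\<in>I. w \<in> S i} \<subset> I" by auto
      then have "card {i\<in>I. w \<in> S i} < card I" using assms(1) by (rule psubset_card_mono[rotated])
      then show ?thesis unfolding eq by auto
    qed
  qed
  also have "\<dots> = (card I - 1) * card ?U + card (?U \<inter> ?V)"
    by (simp only: sum.distrib sum.inter_restrict[OF fU, symmetric]) simp
  also have "?U \<inter> ?V = ?V" using VU by auto
  finally show ?thesis .
qed

text \<open>A quantitative Sauer-Shelah lemma, by induction on \<open>Z\<close>. At a new coordinate
  \<open>z\<close>, either all traces \<open>Y \<inter> A z i\<close> are expensive to cover, and
  then the sets shattered by every trace extend by \<open>z\<close>; or one trace is cheap, and the
  remainder \<open>Y - A z i\<close> carries at least the fraction \<open>1 - \<epsilon>\<close> of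
  the cost. The condition on \<alpha> makes the first case lossless.\<close>

lemma card_shattered_ge:
  fixes A :: "'z \<Rightarrow> 'i \<Rightarrow> 'y set" and \<epsilon> \<alpha> :: real
  assumes "finite Z" "finite I" "2 \<le> card I"
    and "\<And>z. z \<in> Z \<Longrightarrow> disjoint_family_on (A z) I"
    and lam: "0 < \<epsilon>" "\<epsilon> < 1" "0 < \<alpha>" "(real (card I) - 1) / real (card I) \<le> \<epsilon> powr \<alpha>"
  shows "\<exists>k. pattern_cover Y Z (\<lambda>z i. - A z i) I k \<and>
           (1 - \<epsilon>) powr (\<alpha> * real (card Z)) * real k powr \<alpha>
             \<le> real (card {W. W \<subseteq> Z \<and> shatters Y W A I})"
  using assms(1,4)
proof (induction Z arbitrary: Y rule: finite_induct)
  case empty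
  show ?case
  proof (cases "Y = {}")
    case True
    then show ?thesis using pattern_cover_empty by (intro exI[of _ 0]) auto
  next
    case False
    have "pattern_cover Y {} (\<lambda>z i. - A z i) I 1"
      unfolding pattern_cover_def by (rule exI[of _ "{\<lambda>_. undefined}"]) auto
    moreover have "{W. W \<subseteq> {} \<and> shatters Y W A I} = {{}}"
      using False by (auto simp: shatters_def)
    ultimately show ?thesis by (intro exI[of _ 1]) auto
  qed
next
  case (insert z Z)
  define S where "S Y' = {W. W \<subseteq> Z \<and> shatters Y' W A I}" for Y'
  let ?Sh = "{W. W \<subseteq> insert z Z \<and> shatters Y W A I}"
  define \<mu> where "\<mu> = (1 - \<epsilon>) powr (\<alpha> * real (card Z))"
  have fS: "finite (S Y')" for Y'
    by (rule finite_subset[of _ "Pow Z"]) (use insert.hyps in \<open>auto simp: S_def\<close>)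
  have fSh: "finite ?Sh" 
    by (rule finite_subset[of _ "Pow (insert z Z)"]) (use insert.hyps in auto)
  have "\<forall>Y'. \<exists>k. pattern_cover Y' Z (\<lambda>z i. - A z i) I k \<and>
           \<mu> * real k powr \<alpha> \<le> real (card (S Y'))"
    unfolding S_def \<mu>_def using insert.IH insert.prems by auto
  then obtain k where k: "\<And>Y'. pattern_cover Y' Z (\<lambda>z i. - A z i) I (k Y')"
    "\<And>Y'. \<mu> * real (k Y') powr \<alpha> \<le> real (card (S Y'))" by metis
  have Ine: "I \<noteq> {}" using assms(3) by auto
  have S_sub: "S Y' \<subseteq> ?Sh" if "Y' \<subseteq> Y" for Y'
    using that shatters_mono unfolding S_def by blast
  have disj: "disjoint_family_on (A z) I" using insert.prems by simp
  define B where "B i = Y \<inter> A z i" for i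
  define D where "D i = Y - A z i" for i
  have cov: "pattern_cover Y (insert z Z) (\<lambda>z i. - A z i) I (k (B i) + k (D i))"
    if i: "i \<in> I" for i
  proof -
    have "\<exists>j. j \<in> I \<and> j \<noteq> i"
    proof (rule ccontr)
      assume "\<not> ?thesis"
      then have "I \<subseteq> {i}" by auto
      then have "card I \<le> card {i}" by (intro card_mono) auto
      then show False using assms(3) by simp
    qed
    then obtain j where j: "j \<in> I" "j \<noteq> i" by blast
    \<comment> \<open>By disjointness the trace in \<open>A z i\<close> may use another letter
      \<open>j\<close> at \<open>z\<close>, while the remainder \<open>D i\<close> uses
      \<open>i\<close> itself.\<close>
    then have "B i \<subseteq> - A z j" using disj i unfolding B_def disjoint_family_on_def by blast
    then have "pattern_cover (B i) (insert z Z) (\<lambda>z i. - A z i) I (k (B i))"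
      by (intro pattern_cover_insert[OF k(1)]) (use insert.hyps j in auto)
    moreover have "pattern_cover (D i) (insert z Z) (\<lambda>z i. - A z i) I (k (D i))"
      by (intro pattern_cover_insert[OF k(1)]) (use insert.hyps i in \<open>auto simp: D_def\<close>)
    moreover have "B i \<union> D i = Y" unfolding B_def D_def by auto
    ultimately show ?thesis by (metis pattern_cover_Un)
  qed
  \<comment> \<open>The cheapest trace: if it is expensive, then so are all the others.\<close>
  define i where "i = arg_min_on (\<lambda>i. k (B i)) I"
  have iI: "i \<in> I" unfolding i_def by (rule arg_min_if_finite(1)[OF assms(2) Ine])
  have imin: "k (B i) \<le> k (B j)" if "j \<in> I" for j
    unfolding i_def using arg_min_least[OF assms(2) Ine that] .
  define K where "K = k (B i) + k (D i)"
  have mu0: "0 \<le> \<mu>" unfolding \<mu>_def by simp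
  have mu': "(1 - \<epsilon>) powr (\<alpha> * real (card (insert z Z))) = \<mu> * (1 - \<epsilon>) powr \<alpha>"
    unfolding \<mu>_def using insert.hyps lam by (simp add: distrib_left powr_add mult.commute)
  have "\<mu> * (1 - \<epsilon>) powr \<alpha> * real K powr \<alpha> \<le> real (card ?Sh)"
  proof (cases "\<epsilon> * real K \<le> real (k (B i))")
    case True
    let ?c = "real (card I)"
    have c2: "?c \<ge> 2" using assms(3) by simp
    let ?U = "\<Union>j\<in>I. S (B j)" and ?V = "\<Inter>j\<in>I. S (B j)"
    have lower: "\<mu> * ((?c - 1) / ?c * real K powr \<alpha>) \<le> real (card (S (B j)))" if "j \<in> I" for j
    proof -
      have "(?c - 1) / ?c * real K powr \<alpha> \<le> \<epsilon> powr \<alpha> * real K powr \<alpha>"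
        using lam by (intro mult_right_mono) auto
      also have "\<dots> = (\<epsilon> * real K) powr \<alpha>" using lam by (simp add: powr_mult)
      also have "\<dots> \<le> real (k (B j)) powr \<alpha>"
        using True imin[OF that] lam by (intro powr_mono2) auto
      finally have "\<mu> * ((?c - 1) / ?c * real K powr \<alpha>) \<le> \<mu> * real (k (B j)) powr \<alpha>"
        using mu0 by (intro mult_left_mono)
      then show ?thesis using k(2)[of "B j"] by linarith
    qed
    have fU: "finite ?U" using fS assms(2) by auto
    have fV: "finite ?V" using Ine fS by (metis finite_INT ex_in_conv)
    have zV: "W \<subseteq> Z" if "W \<in> ?V" for W using that Ine unfolding S_def by blast
    have zU: "W \<subseteq> Z" if "W \<in> ?U" for W using that unfolding S_def by blast
    \<comment> \<open>A set shattered by every trace is counted twice, with and without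
      \<open>z\<close>; this yields \<open>card ?U + card ?V\<close> shattered sets.\<close>
    have "insert z ` ?V \<subseteq> ?Sh"
    proof
      fix W' assume "W' \<in> insert z ` ?V"
      then obtain W where W: "W' = insert z W" "W \<in> ?V" by auto
      then have "shatters Y W' A I" by (auto intro!: shatters_insert simp: S_def B_def)
      then show "W' \<in> ?Sh" using W zV by auto
    qed
    moreover have "?U \<subseteq> ?Sh" using S_sub by (auto simp: B_def)
    ultimately have "card (?U \<union> insert z ` ?V) \<le> card ?Sh"
      by (intro card_mono[OF fSh]) auto
    moreover have "card (?U \<union> insert z ` ?V) = card ?U + card (insert z ` ?V)"
      using fU fV zU insert.hyps by (intro card_Un_disjoint) auto
    moreover have "card (insert z ` ?V) = card ?V"
      using insert.hyps zV by (intro card_image inj_onI) (metis insert_ident subsetD)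
    ultimately have UV: "card ?U + card ?V \<le> card ?Sh" by simp
    have "?c * (\<mu> * ((?c - 1) / ?c * real K powr \<alpha>)) \<le> (\<Sum>j\<in>I. real (card (S (B j))))"
    proof -
      have "?c * (\<mu> * ((?c - 1) / ?c * real K powr \<alpha>)) =
          (\<Sum>j\<in>I. \<mu> * ((?c - 1) / ?c * real K powr \<alpha>))" by (simp only: sum_constant)
      also have "\<dots> \<le> (\<Sum>j\<in>I. real (card (S (B j))))" by (rule sum_mono) (rule lower)
      finally show ?thesis .
    qed
    also have "\<dots> \<le> real ((card I - 1) * card ?U + card ?V)"
      unfolding of_nat_sum[symmetric] of_nat_le_iff by (rule sum_card_le_UN_INT[OF assms(2) Ine fS])
    \<comment> \<open>As \<open>card I - 1\<close> is at least 1, the intersection may be given the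
      same weight as the union.\<close>
    also have "\<dots> \<le> real ((card I - 1) * card ?Sh)"
    proof -
      have "card ?V \<le> (card I - 1) * card ?V"
        using mult_le_mono1[of 1 "card I - 1" "card ?V"] assms(3) by linarith
      then have "(card I - 1) * card ?U + card ?V \<le> (card I - 1) * (card ?U + card ?V)"
        by (simp add: distrib_left)
      also have "\<dots> \<le> (card I - 1) * card ?Sh" using UV by (rule mult_le_mono2)
      finally show ?thesis by (rule of_nat_mono)
    qed
    finally have bound: "?c * (\<mu> * ((?c - 1) / ?c * real K powr \<alpha>)) \<le> real ((card I - 1) * card ?Sh)" .
    have "(?c - 1) * (\<mu> * real K powr \<alpha>) \<le> (?c - 1) * real (card ?Sh)"
    proof -
      have "?c * (\<mu> * ((?c - 1) / ?c * real K powr \<alpha>)) = (?c - 1) * (\<mu> * real K powr \<alpha>)"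
        using c2 by (simp add: field_simps)
      moreover have "real ((card I - 1) * card ?Sh) = (?c - 1) * real (card ?Sh)"
        using assms(3) by (simp add: of_nat_diff)
      ultimately show ?thesis using bound by metis
    qed
    then have *: "\<mu> * real K powr \<alpha> \<le> real (card ?Sh)" using c2 by simp
    have "\<mu> * (1 - \<epsilon>) powr \<alpha> * real K powr \<alpha> \<le> \<mu> * 1 * real K powr \<alpha>"
      using lam mu0 by (intro mult_right_mono mult_left_mono powr_le1) auto
    then show ?thesis using * by linarith
  next
    case False
    then have "(1 - \<epsilon>) * real K \<le> real (k (D i))" unfolding K_def by (simp add: algebra_simps)
    then have "((1 - \<epsilon>) * real K) powr \<alpha> \<le> real (k (D i)) powr \<alpha>"
      using lam by (intro powr_mono2) auto
    then have "\<mu> * ((1 - \<epsilon>) * real K) powr \<alpha> \<le> \<mu> * real (k (D i)) powr \<alpha>"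
      using mu0 by (intro mult_left_mono)
    also have "\<dots> \<le> real (card (S (D i)))" by (rule k(2))
    also have "\<dots> \<le> real (card ?Sh)"
      by (intro of_nat_mono card_mono[OF fSh] S_sub) (auto simp: D_def)
    finally show ?thesis using lam by (simp add: powr_mult mult.assoc)
  qed
  then show ?case using cov[OF iI] unfolding mu' K_def by blast
qed

text \<open>The binomial theorem as a weighted count of subsets; a small weight \<open>t\<close>
  later replaces tail estimates for binomial coefficients.\<close>

lemma sum_power_card_Pow:
  fixes t :: "'a::comm_semiring_1"
  assumes "finite Z"
  shows "(\<Sum>W\<in>Pow Z. t ^ card W) = (1 + t) ^ card Z"
  using assms
proof (induction rule: finite_induct)
  case (insert z Z)
  have "(\<Sum>W\<in>Pow (insert z Z). t ^ card W) =
      (\<Sum>W\<in>Pow Z. t ^ card W) + (\<Sum>W\<in>insert z ` Pow Z. t ^ card W)"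
    unfolding Pow_insert by (rule sum.union_disjoint) (use insert in auto)
  also have "(\<Sum>W\<in>insert z ` Pow Z. t ^ card W) = (\<Sum>W\<in>Pow Z. t ^ card (insert z W))"
  proof (subst sum.reindex)
    show "inj_on (insert z) (Pow Z)"
      using insert.hyps by (intro inj_onI) (metis PowD insert_ident subsetD)
  qed simp
  also have "\<dots> = (\<Sum>W\<in>Pow Z. t * t ^ card W)"
  proof (rule sum.cong[OF refl])
    fix W assume "W \<in> Pow Z"
    then have "finite W" "z \<notin> W" using insert.hyps finite_subset by auto
    then show "t ^ card (insert z W) = t * t ^ card W" by simp
  qed
  finally show ?case using insert by (simp add: sum_distrib_left[symmetric] distrib_right)
qed simp

text \<open>The preceding lemma gives exponentially many shattered sets. Too few subsets of
  \<open>Z\<close> have fewer than \<open>c * card Z\<close> elements, so one of the shattered sets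
  is large. The constant depends only on \<open>I\<close> and \<open>b\<close>.\<close>

lemma shatters_positive_proportion:
  fixes b :: real
  assumes "finite I" "2 \<le> card I" "0 < b"
  shows "\<exists>c>0. \<forall>(Z :: 'z set) (Y :: 'y set) A. finite Z \<longrightarrow>
      (\<forall>z\<in>Z. disjoint_family_on (A z) I) \<longrightarrow>
      (\<forall>k. pattern_cover Y Z (\<lambda>z i. - A z i) I k \<longrightarrow> exp (b * real (card Z)) \<le> real k) \<longrightarrow>
      (\<exists>W\<subseteq>Z. c * real (card Z) \<le> real (card W) \<and> shatters Y W A I)"
proof -
  \<comment> \<open>With this choice the loss factor \<open>1 - \<epsilon>\<close> per coordinate
    uses up half of the growth rate \<open>b\<close>.\<close>
  define \<epsilon> where "\<epsilon> = 1 - exp (- b / 2)"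
  let ?q = "(real (card I) - 1) / real (card I)"
  \<comment> \<open>The solution of \<open>\<epsilon> powr \<alpha> = ?q\<close>, the ratio that the
    counting lemma requires.\<close>
  define \<alpha> where "\<alpha> = ln ?q / ln \<epsilon>"
  have lam: "0 < \<epsilon>" "\<epsilon> < 1" unfolding \<epsilon>_def using assms(3) by auto
  have q: "0 < ?q" "?q < 1" using assms(2) by auto
  have al: "0 < \<alpha>" unfolding \<alpha>_def 
    using ln_less_zero[OF q] ln_less_zero[OF lam] by (rule divide_neg_neg)
  have "ln \<epsilon> \<noteq> 0" using lam by simp
  then have "\<alpha> * ln \<epsilon> = ln ?q" unfolding \<alpha>_def by simp
  then have la: "\<epsilon> powr \<alpha> = ?q" using lam(1) exp_ln[OF q(1)] unfolding powr_def by simp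
  define a where "a = \<alpha> * b / 2"
  have a: "0 < a" unfolding a_def using al assms(3) by simp
  \<comment> \<open>Small enough that \<open>(1 + t) ^ card Z\<close> grows at rate at most
    \<open>a / 2\<close>; the cap \<open>1/2\<close> keeps \<open>ln t\<close> negative.\<close>
  define t where "t = min (1/2) (exp (a / 2) - 1)"
  have t: "0 < t" "t < 1" "1 + t \<le> exp (a / 2)" unfolding t_def using a by (auto simp: min_def)
  \<comment> \<open>Chosen so that a set of at most \<open>c * card Z\<close> elements has weight at
    least \<open>exp (- a / 4 * card Z)\<close>. If all shattered sets were that small, their total
    weight would have rate \<open>3 / 4 * a\<close>, above the available
    \<open>a / 2\<close>.\<close>
  define c where "c = (a / 4) / (- ln t)"
  have lnt: "ln t < 0" using t by (intro ln_less_zero) auto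
  have c: "0 < c" unfolding c_def using a lnt by (intro divide_pos_pos) auto
  have "\<exists>W\<subseteq>Z. c * real (card Z) \<le> real (card W) \<and> shatters Y W A I"
    if fin: "finite Z" and disj: "\<forall>z\<in>Z. disjoint_family_on (A z) I"
    and cov: "\<forall>k. pattern_cover Y Z (\<lambda>z i. - A z i) I k \<longrightarrow> exp (b * real (card Z)) \<le> real k"
    for Z :: "'z set" and Y :: "'y set" and A
  proof (rule ccontr)
    assume neg: "\<not> ?thesis"
    let ?n = "real (card Z)"
    let ?Sh = "{W. W \<subseteq> Z \<and> shatters Y W A I}"
    obtain k where k: "pattern_cover Y Z (\<lambda>z i. - A z i) I k"
      "(1 - \<epsilon>) powr (\<alpha> * ?n) * real k powr \<alpha> \<le> real (card ?Sh)"
      using card_shattered_ge[OF fin assms(1,2) _ lam al, of A Y] disj la by auto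
    have "exp (a * ?n) = exp (- b / 2) powr (\<alpha> * ?n) * exp (b * ?n) powr \<alpha>"
      unfolding a_def by (simp add: powr_def exp_add[symmetric] algebra_simps)
    also have "\<dots> \<le> (1 - \<epsilon>) powr (\<alpha> * ?n) * real k powr \<alpha>"
      using cov k(1) al by (intro mult_mono powr_mono2) (auto simp: \<epsilon>_def)
    finally have big: "exp (a * ?n) \<le> real (card ?Sh)" using k(2) by linarith
    have fSh: "finite ?Sh" by (rule finite_subset[of _ "Pow Z"]) (use fin in auto)
    have "exp (- a / 4 * ?n) \<le> t ^ card W" if "W \<in> ?Sh" for W
    proof -
      have "real (card W) \<le> c * ?n" using neg that by (metis (mono_tags, lifting) mem_Collect_eq nle_le)
      then have "ln t * (c * ?n) \<le> ln t * real (card W)" using lnt by simp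
      moreover have "ln t * (c * ?n) = - a / 4 * ?n" unfolding c_def using lnt by simp
      moreover have "exp (ln t * real (card W)) = t ^ card W"
        using t(1) by (simp add: exp_of_nat2_mult)
      ultimately show ?thesis by (metis exp_le_cancel_iff)
    qed
    then have "real (card ?Sh) * exp (- a / 4 * ?n) \<le> (\<Sum>W\<in>?Sh. t ^ card W)"
      using sum_mono[of ?Sh "\<lambda>_. exp (- a / 4 * ?n)" "\<lambda>W. t ^ card W"] by simp
    also have "\<dots> \<le> (\<Sum>W\<in>Pow Z. t ^ card W)"
      by (rule sum_mono2) (use fin t in auto)
    also have "\<dots> = (1 + t) ^ card Z" by (rule sum_power_card_Pow[OF fin])
    also have "\<dots> \<le> exp (a / 2) ^ card Z" using t by (intro power_mono) auto
    also have "\<dots> = exp (a / 2 * ?n)" by (metis exp_of_nat2_mult)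
    finally have "real (card ?Sh) * exp (- a / 4 * ?n) \<le> exp (a / 2 * ?n)" .
    with big have "exp (a * ?n) * exp (- a / 4 * ?n) \<le> exp (a / 2 * ?n)"
      by (meson exp_ge_zero mult_right_mono order_trans)
    then have "a * ?n + (- a / 4 * ?n) \<le> a / 2 * ?n" by (simp only: exp_add[symmetric] exp_le_cancel_iff)
    then have "a * ?n \<le> 0" by (simp add: field_simps)
    \<comment> \<open>Only an empty \<open>Z\<close> survives the estimate. There any shattered set
      would already be a witness, so none exists, although \<open>big\<close> provides one.\<close>
    then have "card Z = 0" using a by (simp add: mult_le_0_iff)
    then have "?Sh = {}" using neg by auto
    then show False using big by (simp del: Collect_empty_eq)
  qed
  then show ?thesis using c by blast
qed

section \<open>Joins of covers and the converse count\<close>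

text \<open>Submultiplicativity of covering numbers: one pattern from each factor determines,
  coordinate by coordinate, a member of the join and hence a letter of the coarser family
  \<open>D\<close>.\<close>

lemma pattern_cover_join:
  assumes "finite M" "\<And>m. m \<in> M \<Longrightarrow> pattern_cover Y Z (C m) (I m) (k m)"
    and refines: "\<And>z f. z \<in> Z \<Longrightarrow> f \<in> Pi\<^sub>E M I \<Longrightarrow> \<exists>j\<in>J. Y \<inter> (\<Inter>m\<in>M. C m z (f m)) \<subseteq> D z j"
  shows "pattern_cover Y Z D J (\<Prod>m\<in>M. k m)"
proof -
  have "\<forall>m. \<exists>\<Phi>. m \<in> M \<longrightarrow> finite \<Phi> \<and> card \<Phi> \<le> k m \<and> \<Phi> \<subseteq> Z \<rightarrow> I m \<and>
      (\<forall>y\<in>Y. \<exists>p\<in>\<Phi>. \<forall>z\<in>Z. y \<in> C m z (p z))"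
    using assms(2) unfolding pattern_cover_def by metis
  then obtain \<Phi> where \<Phi>: "\<And>m. m \<in> M \<Longrightarrow> finite (\<Phi> m)" "\<And>m. m \<in> M \<Longrightarrow> card (\<Phi> m) \<le> k m"
      "\<And>m. m \<in> M \<Longrightarrow> \<Phi> m \<subseteq> Z \<rightarrow> I m"
      "\<And>m y. m \<in> M \<Longrightarrow> y \<in> Y \<Longrightarrow> \<exists>p\<in>\<Phi> m. \<forall>z\<in>Z. y \<in> C m z (p z)"
    by metis
  have "\<forall>z f. \<exists>j. z \<in> Z \<longrightarrow> f \<in> Pi\<^sub>E M I \<longrightarrow> j \<in> J \<and> Y \<inter> (\<Inter>m\<in>M. C m z (f m)) \<subseteq> D z j"
    using refines by metis
  then obtain r where r: "\<And>z f. z \<in> Z \<Longrightarrow> f \<in> Pi\<^sub>E M I \<Longrightarrow> r z f \<in> J"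
      "\<And>z f. z \<in> Z \<Longrightarrow> f \<in> Pi\<^sub>E M I \<Longrightarrow> Y \<inter> (\<Inter>m\<in>M. C m z (f m)) \<subseteq> D z (r z f)"
    by metis
  define h where "h q z = r z (\<lambda>m\<in>M. q m z)" for q z
  let ?\<Psi> = "h ` Pi\<^sub>E M \<Phi>"
  have fin: "finite (Pi\<^sub>E M \<Phi>)" using assms(1) \<Phi>(1) by (rule finite_PiE)
  have in_PiE: "(\<lambda>m\<in>M. q m z) \<in> Pi\<^sub>E M I" if "q \<in> Pi\<^sub>E M \<Phi>" "z \<in> Z" for q z
  proof (intro restrict_PiE_iff[THEN iffD2] ballI)
    fix m assume m: "m \<in> M"
    have "q m \<in> \<Phi> m" using PiE_mem[OF that(1) m] .
    then show "q m z \<in> I m" using \<Phi>(3)[OF m] that(2) by blast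
  qed
  have "card ?\<Psi> \<le> card (Pi\<^sub>E M \<Phi>)" by (rule card_image_le[OF fin])
  also have "\<dots> = (\<Prod>m\<in>M. card (\<Phi> m))" by (rule card_PiE[OF assms(1)])
  also have "\<dots> \<le> (\<Prod>m\<in>M. k m)" using \<Phi>(2) by (intro prod_mono) auto
  finally have card: "card ?\<Psi> \<le> (\<Prod>m\<in>M. k m)" .
  have sub: "?\<Psi> \<subseteq> Z \<rightarrow> J" 
  proof (intro image_subsetI funcsetI)
    fix q z assume "q \<in> Pi\<^sub>E M \<Phi>" "z \<in> Z"
    then show "h q z \<in> J" unfolding h_def by (intro r(1) in_PiE)
  qed
  have cov: "\<exists>p\<in>?\<Psi>. \<forall>z\<in>Z. y \<in> D z (p z)" if y: "y \<in> Y" for y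
  proof -
    have "\<forall>m. \<exists>p. m \<in> M \<longrightarrow> p \<in> \<Phi> m \<and> (\<forall>z\<in>Z. y \<in> C m z (p z))" using \<Phi>(4) y by metis
    then obtain p where p: "\<And>m. m \<in> M \<Longrightarrow> p m \<in> \<Phi> m"
      "\<And>m z. m \<in> M \<Longrightarrow> z \<in> Z \<Longrightarrow> y \<in> C m z (p m z)" by metis
    let ?q = "\<lambda>m\<in>M. p m"
    have q: "?q \<in> Pi\<^sub>E M \<Phi>" using p(1) by auto
    have "y \<in> D z (h ?q z)" if z: "z \<in> Z" for z
    proof -
      have "y \<in> Y \<inter> (\<Inter>m\<in>M. C m z ((\<lambda>m\<in>M. ?q m z) m))" using p(2) z y by auto
      then show ?thesis using r(2)[OF z in_PiE[OF q z]] unfolding h_def by blast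
    qed
    then show ?thesis using q by (intro bexI[of _ "h ?q"] ballI imageI)
  qed
  show ?thesis unfolding pattern_cover_def
    using fin card sub cov by (intro exI[of _ ?\<Psi>] conjI ballI finite_imageI)
qed

text \<open>A point covered by the pattern \<open>p\<close> avoids \<open>A z (p z)\<close>, so it
  can realize only choices with \<sigma> different from \<open>p\<close> everywhere on
  \<open>W\<close>. Each pattern thus accounts for at most \<open>(card I - 1) ^ card W\<close> of
  the \<open>card I ^ card W\<close> choices.\<close>

lemma pattern_cover_shatters_card:
  assumes "shatters Y W A I" "pattern_cover Y Z (\<lambda>z i. - A z i) I k" "W \<subseteq> Z" "finite W" "finite I"
  shows "card I ^ card W \<le> k * (card I - 1) ^ card W"
proof -
  obtain \<Phi> where \<Phi>: "finite \<Phi>" "card \<Phi> \<le> k" "\<Phi> \<subseteq> Z \<rightarrow> I"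
    "\<forall>y\<in>Y. \<exists>p\<in>\<Phi>. \<forall>z\<in>Z. y \<in> - A z (p z)"
    using assms(2) unfolding pattern_cover_def by metis
  let ?B = "\<lambda>p. Pi\<^sub>E W (\<lambda>z. I - {p z})"
  have "Pi\<^sub>E W (\<lambda>_. I) \<subseteq> (\<Union>p\<in>\<Phi>. ?B p)"
  proof
    fix \<sigma> assume \<sigma>: "\<sigma> \<in> Pi\<^sub>E W (\<lambda>_. I)"
    then obtain y where y: "y \<in> Y" "\<forall>z\<in>W. y \<in> A z (\<sigma> z)"
      using assms(1) unfolding shatters_def by blast
    obtain p where p: "p \<in> \<Phi>" "\<forall>z\<in>Z. y \<in> - A z (p z)" using bspec[OF \<Phi>(4) y(1)] by (elim bexE)
    have "\<sigma> z \<noteq> p z" if "z \<in> W" for z using that y(2) p(2) assms(3) by (metis ComplD subsetD)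
    then have "\<sigma> \<in> ?B p" using \<sigma> by (auto simp: PiE_iff)
    then show "\<sigma> \<in> (\<Union>p\<in>\<Phi>. ?B p)" using p(1) by blast
  qed
  moreover have "finite (\<Union>p\<in>\<Phi>. ?B p)" using \<Phi>(1) assms(4,5) by (auto intro!: finite_PiE)
  ultimately have "card (Pi\<^sub>E W (\<lambda>_. I)) \<le> card (\<Union>p\<in>\<Phi>. ?B p)" by (rule card_mono[rotated])
  also have "\<dots> \<le> (\<Sum>p\<in>\<Phi>. card (?B p))" by (rule card_UN_le[OF \<Phi>(1)])
  also have "\<dots> \<le> (\<Sum>p\<in>\<Phi>. (card I - 1) ^ card W)"
  proof (rule sum_mono)
    fix p assume p: "p \<in> \<Phi>"
    have "card (?B p) = (\<Prod>z\<in>W. card (I - {p z}))" by (rule card_PiE[OF assms(4)])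
    also have "\<dots> = (\<Prod>z\<in>W. card I - 1)"
      by (rule prod.cong[OF refl], rule card_Diff_singleton) (use p \<Phi>(3) assms(3) in auto)
    finally show "card (?B p) \<le> (card I - 1) ^ card W" by simp
  qed
  also have "\<dots> \<le> k * (card I - 1) ^ card W" using \<Phi>(2) by simp
  finally show ?thesis using assms(4) by (simp add: card_PiE)
qed

section \<open>Overlapping and displaced finite sets\<close>

text \<open>A Bonferroni inequality, with the number of pairs rounded up to
  \<open>card M ^ 2\<close>.\<close>

lemma card_UN_ge_of_small_overlaps:
  fixes x d :: real
  assumes "finite M" "\<And>i. i \<in> M \<Longrightarrow> finite (B i)" "\<And>i. i \<in> M \<Longrightarrow> x \<le> real (card (B i))"
    and "\<And>i j. i \<in> M \<Longrightarrow> j \<in> M \<Longrightarrow> i \<noteq> j \<Longrightarrow> real (card (B i \<inter> B j)) \<le> d" and "0 \<le> d"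
  shows "real (card M) * x - real (card M) ^ 2 * d \<le> real (card (\<Union>i\<in>M. B i))"
  using assms(1-4)
proof (induction M rule: finite_induct)
  case (insert i M)
  let ?U = "\<Union>j\<in>M. B j"
  have fU: "finite ?U" and fB: "finite (B i)" using insert by auto
  have "real (card (B i \<inter> ?U)) = real (card (\<Union>j\<in>M. B i \<inter> B j))" by (simp only: Int_UN_distrib)
  also have "\<dots> \<le> (\<Sum>j\<in>M. real (card (B i \<inter> B j)))"
    using card_UN_le[OF insert.hyps(1), of "\<lambda>j. B i \<inter> B j"] by (metis of_nat_le_iff of_nat_sum)
  also have "\<dots> \<le> (\<Sum>j\<in>M. d)" using insert by (intro sum_mono) auto
  finally have *: "real (card (B i \<inter> ?U)) \<le> real (card M) * d" by simp
  have "real (card (B i)) + real (card ?U) = real (card (B i \<union> ?U)) + real (card (B i \<inter> ?U))"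
    using card_Un_Int[OF fB fU] by (metis of_nat_add)
  moreover have "real (card M) * x - real (card M) ^ 2 * d \<le> real (card ?U)"
    using insert by auto
  moreover have "x \<le> real (card (B i))" using insert by auto
  moreover have "real (card M) ^ 2 * d + real (card M) * d \<le> (real (card M) + 1)^2 * d"
    using assms(5) by (simp add: power2_eq_square algebra_simps)
  moreover have "real (card (insert i M)) = real (card M) + 1" using insert.hyps by simp
  moreover have "(real (card M) + 1) * x = real (card M) * x + x" by (simp add: distrib_right)
  ultimately show ?case using * by (simp only: UN_insert)
qed simp

lemma displaced_third:
  assumes "finite H" "inj_on f H" "\<And>h. h \<in> H \<Longrightarrow> f h \<noteq> h"
  shows "\<exists>J\<subseteq>H. f ` J \<inter> J = {} \<and> card H \<le> 3 * card J"
proof -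
  let ?P = "\<lambda>J. J \<subseteq> H \<and> f ` J \<inter> J = {}"
  have "\<exists>J. ?P J \<and> (\<forall>J'. ?P J' \<longrightarrow> card J' \<le> card J)"
    by (rule ex_has_greatest_nat[of ?P "{}" card "Suc (card H)"]) (auto intro: card_mono assms(1) simp: less_Suc_eq_le)
  then obtain J where J: "J \<subseteq> H" "f ` J \<inter> J = {}" "\<And>J'. ?P J' \<Longrightarrow> card J' \<le> card J" by blast
  have fJ: "finite J" using J(1) assms(1) finite_subset by blast
  let ?R = "{h\<in>H. f h \<in> J}"
  have "H \<subseteq> J \<union> f ` J \<union> ?R"
  proof
    fix h assume h: "h \<in> H"
    show "h \<in> J \<union> f ` J \<union> ?R"
    proof (rule ccontr)
      assume *: "\<not> ?thesis"
      have "?P (insert h J)" using * h J(1,2) assms(3) by auto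
      then have "card (insert h J) \<le> card J" by (rule J(3))
      then show False using * fJ by simp
    qed
  qed
  moreover have "finite ?R" using assms(1) by simp
  ultimately have "card H \<le> card (J \<union> f ` J \<union> ?R)" using fJ by (intro card_mono) auto
  also have "\<dots> \<le> card J + card (f ` J) + card ?R"
    by (meson card_Un_le add_le_mono1 le_trans)
  also have "\<dots> \<le> card J + card J + card J"
  proof -
    have "card (f ` J) \<le> card J" by (rule card_image_le[OF fJ])
    moreover have "card ?R \<le> card J"
      by (rule card_inj_on_le[of f]) (use assms(2) fJ in \<open>auto intro: inj_on_subset\<close>)
    ultimately show ?thesis by simp
  qed
  finally show ?thesis using J by (intro exI[of _ J]) auto
qed

subsection \<open>Covers of exponential growth and independence of positive density\<close>

locale folner_system = G_system G X \<phi>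
  for G (structure) and X :: "'x::metric_space set" and \<phi> +
  fixes F :: "nat \<Rightarrow> 'a set"
  assumes infinite_group: "infinite (carrier G)"
    and folner: "folner_sequence G F"
begin

sublocale group G
  using group_hom by (simp add: group_hom_def)

text \<open>Positivity of the upper growth rate of the covering numbers along \<open>F\<close>.
  Asking for infinitely many \<open>n\<close> avoids any question of convergence.\<close>

definition exponential_growth :: "('i \<Rightarrow> 'x set) \<Rightarrow> 'i set \<Rightarrow> bool" where
  "exponential_growth C I \<longleftrightarrow>
     (\<exists>c>0. \<exists>\<^sub>F n in sequentially. \<forall>k. pattern_cover X (F n) (\<lambda>g i. {x. \<phi> g x \<in> C i}) I k \<longrightarrow>
        exp (c * real (card (F n))) \<le> real k)"

definition positive_density :: "('i \<Rightarrow> 'x set) \<Rightarrow> 'i set \<Rightarrow> bool" where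
  "positive_density A I \<longleftrightarrow>
     (\<exists>c>0. \<exists>\<^sub>F n in sequentially. \<exists>J\<subseteq>F n. c * real (card (F n)) \<le> real (card J) \<and>
        shatters X J (\<lambda>g i. {x. \<phi> g x \<in> A i}) I)"

lemma folner_finite: "finite (F n)" and folner_nonempty: "F n \<noteq> {}"
  and folner_subset: "F n \<subseteq> carrier G"
  using folner unfolding folner_sequence_def by auto

lemma card_folner_pos: "0 < real (card (F n))"
  using folner_finite[of n] folner_nonempty[of n] by (simp add: card_gt_0_iff)

lemma action_in_space: "g \<in> carrier G \<Longrightarrow> x \<in> X \<Longrightarrow> \<phi> g x \<in> X"
  using element_image by blast

lemma continuous_action: "g \<in> carrier G \<Longrightarrow> continuous_on X (\<phi> g)"
  using homeo unfolding homeomorphism_def by blast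

text \<open>The proportion supplied by the counting argument depends only on the rate and on
  \<open>I\<close>, so one constant serves all the \<open>n\<close> in question.\<close>

lemma exponential_growth_imp_positive_density:
  assumes "finite I" "2 \<le> card I" "disjoint_family_on A I"
    and growth: "exponential_growth (\<lambda>i. - A i) I"
  shows "positive_density A I"
proof -
  obtain b where b: "0 < b" and freq: "\<exists>\<^sub>F n in sequentially. \<forall>k.
      pattern_cover X (F n) (\<lambda>g i. {x. \<phi> g x \<in> - A i}) I k \<longrightarrow> exp (b * real (card (F n))) \<le> real k"
    using growth unfolding exponential_growth_def by blast
  obtain c where c: "0 < c" and shat: "\<And>(Z :: 'a set) (Y :: 'x set) A. finite Z \<Longrightarrow>
      (\<forall>z\<in>Z. disjoint_family_on (A z) I) \<Longrightarrow>
      (\<forall>k. pattern_cover Y Z (\<lambda>z i. - A z i) I k \<longrightarrow> exp (b * real (card Z)) \<le> real k) \<Longrightarrow>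
      (\<exists>W\<subseteq>Z. c * real (card Z) \<le> real (card W) \<and> shatters Y W A I)"
    using shatters_positive_proportion[OF assms(1,2) b] by metis
  have eq: "(\<lambda>g i. {x. \<phi> g x \<in> - A i}) = (\<lambda>g i. - {x. \<phi> g x \<in> A i})" by auto
  have disj: "\<forall>z\<in>Z. disjoint_family_on (\<lambda>i. {x. \<phi> z x \<in> A i}) I" for Z
    using assms(3) unfolding disjoint_family_on_def by blast
  have "\<exists>\<^sub>F n in sequentially. \<exists>J\<subseteq>F n. c * real (card (F n)) \<le> real (card J) \<and>
      shatters X J (\<lambda>g i. {x. \<phi> g x \<in> A i}) I"
    using freq unfolding eq by (rule frequently_elim1) (rule shat[OF folner_finite disj])
  then show ?thesis unfolding positive_density_def using c by blast
qed

text \<open>Each shattered coordinate multiplies the required number of patterns by at least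
  \<open>q\<close>, so the growth rate is at least \<open>c * ln q\<close>.\<close>

lemma positive_density_imp_exponential_growth:
  assumes "finite I" "2 \<le> card I" and dens: "positive_density A I"
  shows "exponential_growth (\<lambda>i. - A i) I"
proof -
  obtain c where c: "0 < c" and freq: "\<exists>\<^sub>F n in sequentially. \<exists>J\<subseteq>F n.
      c * real (card (F n)) \<le> real (card J) \<and> shatters X J (\<lambda>g i. {x. \<phi> g x \<in> A i}) I"
    using dens unfolding positive_density_def by blast
  let ?c = "real (card I)"
  define q where "q = ?c / (?c - 1)"
  have c2: "?c \<ge> 2" using assms(2) by simp
  have q: "1 < q" using c2 unfolding q_def by simp
  have eq: "(\<lambda>g i. {x. \<phi> g x \<in> - A i}) = (\<lambda>g i. - {x. \<phi> g x \<in> A i})" by auto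
  have "\<exists>\<^sub>F n in sequentially. \<forall>k. pattern_cover X (F n) (\<lambda>g i. {x. \<phi> g x \<in> - A i}) I k \<longrightarrow>
      exp ((c * ln q) * real (card (F n))) \<le> real k"
    using freq
  proof (rule frequently_elim1)
    fix n assume "\<exists>J\<subseteq>F n. c * real (card (F n)) \<le> real (card J) \<and>
        shatters X J (\<lambda>g i. {x. \<phi> g x \<in> A i}) I"
    then obtain J where J: "J \<subseteq> F n" "c * real (card (F n)) \<le> real (card J)"
      "shatters X J (\<lambda>g i. {x. \<phi> g x \<in> A i}) I" by blast
    have fJ: "finite J" using J(1) folner_finite finite_subset by blast
    show "\<forall>k. pattern_cover X (F n) (\<lambda>g i. {x. \<phi> g x \<in> - A i}) I k \<longrightarrow>
        exp ((c * ln q) * real (card (F n))) \<le> real k"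
    proof (intro allI impI)
      fix k assume "pattern_cover X (F n) (\<lambda>g i. {x. \<phi> g x \<in> - A i}) I k"
      then have "card I ^ card J \<le> k * (card I - 1) ^ card J"
        unfolding eq by (rule pattern_cover_shatters_card[OF J(3) _ J(1) fJ assms(1)])
      then have "real (card I ^ card J) \<le> real (k * (card I - 1) ^ card J)" by (rule of_nat_mono)
      then have "?c ^ card J \<le> real k * (?c - 1) ^ card J"
        using assms(2) by (simp add: of_nat_diff)
      then have "q ^ card J \<le> real k"
        using c2 unfolding q_def by (simp add: power_divide pos_divide_le_eq)
      moreover have "exp ((c * ln q) * real (card (F n))) \<le> exp (ln q * real (card J))"
        using mult_left_mono[OF J(2), of "ln q"] q by (simp add: mult_ac)
      moreover have "exp (ln q * real (card J)) = q ^ card J"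
        using q by (simp add: exp_of_nat2_mult)
      ultimately show "exp ((c * ln q) * real (card (F n))) \<le> real k" by linarith
    qed
  qed
  moreover have "0 < c * ln q" using c q by simp
  ultimately show ?thesis unfolding exponential_growth_def by blast
qed

text \<open>If every factor had subexponential covers for all large \<open>n\<close>, the product of
  their covering numbers would be too small for the family \<open>D\<close> that their join
  refines.\<close>

lemma exponential_growth_join:
  assumes growth: "exponential_growth D J" and "finite M"
    and refines: "\<And>f. f \<in> Pi\<^sub>E M I \<Longrightarrow> \<exists>j\<in>J. X \<inter> (\<Inter>m\<in>M. C m (f m)) \<subseteq> D j"
  shows "\<exists>m\<in>M. exponential_growth (C m) (I m)"
proof (rule ccontr)
  assume neg: "\<not> ?thesis"
  let ?cov = "\<lambda>C I n k. pattern_cover X (F n) (\<lambda>g i. {x. \<phi> g x \<in> C i}) I k"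
  obtain c where c: "0 < c"
    "\<exists>\<^sub>F n in sequentially. \<forall>k. ?cov D J n k \<longrightarrow> exp (c * real (card (F n))) \<le> real k"
    using growth unfolding exponential_growth_def by blast
  \<comment> \<open>The added 1 makes \<open>card M * c'\<close> strictly less than \<open>c\<close>
    and keeps the quotient meaningful for empty \<open>M\<close>.\<close>
  define c' where "c' = c / (real (card M) + 1)"
  have c': "0 < c'" unfolding c'_def using c(1) by (intro divide_pos_pos) auto
  have "\<forall>m\<in>M. \<forall>\<^sub>F n in sequentially. \<exists>k. ?cov (C m) (I m) n k \<and> real k < exp (c' * real (card (F n)))"
  proof
    fix m assume "m \<in> M"
    then have "\<not> exponential_growth (C m) (I m)" using neg by blast
    then have "\<not> (\<exists>\<^sub>F n in sequentially. \<forall>k. ?cov (C m) (I m) n k \<longrightarrow> exp (c' * real (card (F n))) \<le> real k)"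
      using c' unfolding exponential_growth_def by blast
    then show "\<forall>\<^sub>F n in sequentially. \<exists>k. ?cov (C m) (I m) n k \<and> real k < exp (c' * real (card (F n)))"
      unfolding not_frequently by (rule eventually_mono) (auto simp: not_le)
  qed
  then have "\<forall>\<^sub>F n in sequentially. \<forall>m\<in>M. \<exists>k. ?cov (C m) (I m) n k \<and> real k < exp (c' * real (card (F n)))"
    by (rule eventually_ball_finite[OF assms(2)])
  with c(2) have "\<exists>n. (\<forall>m\<in>M. \<exists>k. ?cov (C m) (I m) n k \<and> real k < exp (c' * real (card (F n)))) \<and>
      (\<forall>k. ?cov D J n k \<longrightarrow> exp (c * real (card (F n))) \<le> real k)"
    by (rule frequently_ex[OF frequently_eventually_conj])
  then obtain n where n: "\<And>k. ?cov D J n k \<Longrightarrow> exp (c * real (card (F n))) \<le> real k"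
    "\<forall>m\<in>M. \<exists>k. ?cov (C m) (I m) n k \<and> real k < exp (c' * real (card (F n)))" by blast
  then obtain k where k: "\<And>m. m \<in> M \<Longrightarrow> ?cov (C m) (I m) n (k m)"
    "\<And>m. m \<in> M \<Longrightarrow> real (k m) < exp (c' * real (card (F n)))" by metis
  have "?cov D J n (\<Prod>m\<in>M. k m)"
  proof (rule pattern_cover_join[OF assms(2) k(1)])
    fix z f assume z: "z \<in> F n" and f: "f \<in> Pi\<^sub>E M I"
    obtain j where "j \<in> J" "X \<inter> (\<Inter>m\<in>M. C m (f m)) \<subseteq> D j" using refines[OF f] by blast
    moreover have "\<phi> z x \<in> X" if "x \<in> X" for x
      using action_in_space that z folner_subset by blast
    ultimately show "\<exists>j\<in>J. X \<inter> (\<Inter>m\<in>M. {x. \<phi> z x \<in> C m (f m)}) \<subseteq> {x. \<phi> z x \<in> D j}"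
      by (intro bexI[of _ j]) auto
  qed
  then have "exp (c * real (card (F n))) \<le> real (\<Prod>m\<in>M. k m)" by (rule n(1))
  also have "\<dots> \<le> (\<Prod>m\<in>M. exp (c' * real (card (F n))))"
    unfolding of_nat_prod using k(2) by (intro prod_mono) (auto intro: less_imp_le)
  also have "\<dots> = exp (real (card M) * (c' * real (card (F n))))"
    by (simp add: exp_of_nat_mult)
  also have "\<dots> < exp ((real (card M) + 1) * (c' * real (card (F n))))"
    using c' card_folner_pos[of n] by (simp add: distrib_right)
  also have "(real (card M) + 1) * (c' * real (card (F n))) = c * real (card (F n))"
    unfolding c'_def by (simp add: add_nonneg_eq_0_iff)
  finally show False by simp
qed

section \<open>Operations that preserve positive density\<close>

text \<open>Translate to growth and split a join. A member of the join of the covers by complements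
  of the shrunk tuples lies in some \<open>- A j\<close>: a letter other than \<open>i\<close> names
  an unshrunk set, and if all letters are \<open>i\<close>, then every piece of \<open>A i\<close>
  is avoided, hence \<open>A i\<close> itself.\<close>

lemma positive_density_split:
  assumes dens: "positive_density A I" and I: "finite I" "2 \<le> card I" "disjoint_family_on A I"
    and "i \<in> I" "finite M" and cover: "A i \<subseteq> (\<Union>m\<in>M. B m)"
  shows "\<exists>m\<in>M. positive_density (A(i := A i \<inter> B m)) I"
proof -
  let ?A = "\<lambda>m. A(i := A i \<inter> B m)"
  have "\<exists>m\<in>M. exponential_growth (\<lambda>j. - ?A m j) I"
  proof (rule exponential_growth_join[OF _ assms(6)])
    show "exponential_growth (\<lambda>j. - A j) I"
      by (rule positive_density_imp_exponential_growth[OF I(1,2) dens])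
    fix f assume f: "f \<in> M \<rightarrow>\<^sub>E I"
    show "\<exists>j\<in>I. X \<inter> (\<Inter>m\<in>M. - ?A m (f m)) \<subseteq> - A j"
    proof (cases "\<exists>m\<in>M. f m \<noteq> i")
      case True
      then obtain m where "m \<in> M" "f m \<noteq> i" by blast
      moreover from this have "- ?A m (f m) = - A (f m)" by simp
      moreover have "f m \<in> I" using f \<open>m \<in> M\<close> by auto
      ultimately show ?thesis by blast
    next
      case False
      then show ?thesis using cover assms(5) by (intro bexI[of _ i]) auto
    qed
  qed
  then obtain m where m: "m \<in> M" "exponential_growth (\<lambda>j. - ?A m j) I" by blast
  have "disjoint_family_on (?A m) I"
    using I(3) unfolding disjoint_family_on_def by auto
  then show ?thesis
    using exponential_growth_imp_positive_density[OF I(1,2) _ m(2)] m(1) by blast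
qed

text \<open>A choice for \<open>I'\<close> becomes one for \<open>I\<close> by composing with
  \<open>r\<close>; this later transports a pair indexed by letters to words of length one.\<close>

lemma positive_density_reindex:
  assumes "positive_density A I" "r \<in> I' \<rightarrow> I" "\<And>i. i \<in> I' \<Longrightarrow> A (r i) \<subseteq> A' i"
  shows "positive_density A' I'"
proof -
  have *: "shatters X J (\<lambda>g i. {x. \<phi> g x \<in> A' i}) I'"
    if J: "shatters X J (\<lambda>g i. {x. \<phi> g x \<in> A i}) I" for J
    unfolding shatters_def
  proof
    fix \<sigma> assume \<sigma>: "\<sigma> \<in> J \<rightarrow> I'"
    then have "(\<lambda>g. r (\<sigma> g)) \<in> J \<rightarrow> I" using assms(2) by auto
    then obtain x where "x \<in> X" "\<forall>g\<in>J. \<phi> g x \<in> A (r (\<sigma> g))"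
      using shattersD[OF J] by fastforce
    then show "\<exists>x\<in>X. \<forall>g\<in>J. x \<in> {x. \<phi> g x \<in> A' (\<sigma> g)}"
      using assms(3) \<sigma> by (intro bexI[of _ x]) auto
  qed
  obtain c where c: "0 < c" "\<exists>\<^sub>F n in sequentially. \<exists>J\<subseteq>F n.
      c * real (card (F n)) \<le> real (card J) \<and> shatters X J (\<lambda>g i. {x. \<phi> g x \<in> A i}) I"
    using assms(1) unfolding positive_density_def by blast
  have "\<exists>\<^sub>F n in sequentially. \<exists>J\<subseteq>F n.
      c * real (card (F n)) \<le> real (card J) \<and> shatters X J (\<lambda>g i. {x. \<phi> g x \<in> A' i}) I'"
    using c(2) by (rule frequently_elim1) (use * in blast)
  then show ?thesis unfolding positive_density_def using c(1) by blast
qed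

lemma positive_density_nonempty:
  assumes "positive_density A I" "i \<in> I"
  shows "X \<inter> A i \<noteq> {}"
proof -
  obtain c where c: "0 < c" "\<exists>\<^sub>F n in sequentially. \<exists>J\<subseteq>F n.
      c * real (card (F n)) \<le> real (card J) \<and> shatters X J (\<lambda>g i. {x. \<phi> g x \<in> A i}) I"
    using assms(1) unfolding positive_density_def by blast
  obtain n J where J: "J \<subseteq> F n" "c * real (card (F n)) \<le> real (card J)"
    "shatters X J (\<lambda>g i. {x. \<phi> g x \<in> A i}) I" using frequently_ex[OF c(2)] by blast
  have "0 < c * real (card (F n))" using c(1) card_folner_pos by simp
  then have "J \<noteq> {}" using J(2) by auto
  then obtain g where g: "g \<in> J" by blast
  have "(\<lambda>_. i) \<in> J \<rightarrow> I" using assms(2) by simp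
  then obtain x where "x \<in> X" "\<forall>g\<in>J. \<phi> g x \<in> A i"
    using shattersD[OF J(3)] by fastforce
  then have "\<phi> g x \<in> X \<inter> A i" using g J(1) folner_subset action_in_space by blast
  then show ?thesis by blast
qed

section \<open>Return times of sets of positive density\<close>

text \<open>Greedy choice: at each stage only finitely many elements are forbidden, and the group is
  infinite.\<close>

lemma separated_finite_subset:
  assumes "finite K"
  shows "\<exists>S\<subseteq>carrier G. finite S \<and> card S = m \<and>
    (\<forall>a\<in>S. \<forall>b\<in>S. a \<noteq> b \<longrightarrow> inv b \<otimes> a \<notin> K)"
proof (induction m)
  case 0
  show ?case by (intro exI[of _ "{}"]) auto
next
  case (Suc m)
  then obtain S where S: "S \<subseteq> carrier G" "finite S" "card S = m"
    "\<forall>a\<in>S. \<forall>b\<in>S. a \<noteq> b \<longrightarrow> inv b \<otimes> a \<notin> K" by blast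
  let ?K = "K \<inter> carrier G"
  let ?bad = "S \<union> (\<Union>a\<in>S. \<Union>k\<in>?K. {a \<otimes> k, a \<otimes> inv k})"
  have "finite ?bad" using S(2) assms by auto
  then have "\<not> carrier G \<subseteq> ?bad" using infinite_group finite_subset by blast
  then obtain x where x: "x \<in> carrier G" "x \<notin> ?bad" by blast
  have new: "inv a \<otimes> x \<notin> K \<and> inv x \<otimes> a \<notin> K" if a: "a \<in> S" for a
  proof -
    have aG: "a \<in> carrier G" using S(1) a by blast
    have "x = a \<otimes> (inv a \<otimes> x)" using aG x(1) by (simp add: m_assoc[symmetric])
    moreover have "x = a \<otimes> inv (inv x \<otimes> a)"
      using aG x(1) by (simp add: inv_mult_group m_assoc[symmetric])
    moreover have "inv a \<otimes> x \<in> carrier G" "inv x \<otimes> a \<in> carrier G" using aG x(1) by auto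
    ultimately show ?thesis using x(2) a by blast
  qed
  have "card (insert x S) = Suc m" using S(2,3) x(2) by auto
  moreover have "\<forall>a\<in>insert x S. \<forall>b\<in>insert x S. a \<noteq> b \<longrightarrow> inv b \<otimes> a \<notin> K"
    using S(4) new by blast
  ultimately show ?case using S(1,2) x(1) by (intro exI[of _ "insert x S"]) auto
qed

text \<open>Positive density forces returns: \<open>m > 4/c\<close> translates of a subset of \<open>F n\<close> of density \<open>c\<close>
  almost stay inside \<open>F n\<close>, so two of them overlap in positive density.\<close>

lemma overlapping_translates:
  assumes "0 < c" and "finite K"
  shows "\<exists>T\<subseteq>carrier G - K. finite T \<and> (\<exists>d>0. \<forall>\<^sub>F n in sequentially. \<forall>J\<subseteq>F n.
    c * real (card (F n)) \<le> real (card J) \<longrightarrow>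
    (\<exists>g\<in>T. d * real (card (F n)) \<le> real (card {h\<in>J. g \<otimes> h \<in> J})))"
proof -
  obtain m :: nat where m: "4 / c < real m" using reals_Archimedean2 by blast
  then have m0: "0 < real m" using assms(1) by (meson divide_pos_pos less_trans zero_less_numeral)
  have mc: "4 \<le> real m * c" using m assms(1) by (simp add: pos_divide_less_eq)
  obtain S where S: "S \<subseteq> carrier G" "finite S" "card S = m"
    "\<forall>a\<in>S. \<forall>b\<in>S. a \<noteq> b \<longrightarrow> inv b \<otimes> a \<notin> K" using separated_finite_subset[OF assms(2), of m] by blast
  \<comment> \<open>\<open>S\<close>, and with it the finite set \<open>T\<close>, is fixed before
    \<open>n\<close>; this later allows one element of \<open>T\<close> to serve infinitely many
    \<open>n\<close>.\<close>
  define T where "T = {inv b \<otimes> a |a b. a \<in> S \<and> b \<in> S \<and> a \<noteq> b}"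
  have "T \<subseteq> (\<lambda>(a, b). inv b \<otimes> a) ` (S \<times> S)" unfolding T_def by auto
  then have finT: "finite T" using S(2) by (meson finite_SigmaI finite_imageI finite_subset)
  have TK: "T \<subseteq> carrier G - K" unfolding T_def using S(1,4) by auto
  \<comment> \<open>If all overlaps were at most \<open>d * card (F n)\<close>, their total
    correction would be \<open>card (F n)\<close>. The translates would then fill at least 4 - 1 = 3
    times \<open>card (F n)\<close>, while their union has at most twice that cardinality.\<close>
  define d where "d = 1 / (real m)^2"
  have d: "0 < d" unfolding d_def using m0 by simp
  have "\<forall>\<^sub>F n in sequentially. \<forall>a\<in>S.
      real (card (sym_diff (a <# F n) (F n))) / real (card (F n)) < 1 / real m"
  proof (rule eventually_ball_finite[OF S(2)], rule ballI)
    fix a assume "a \<in> S"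
    then have "(\<lambda>n. real (card (sym_diff (a <# F n) (F n))) / real (card (F n))) \<longlonglongrightarrow> 0"
      using folner S(1) unfolding folner_sequence_def by blast
    then show "\<forall>\<^sub>F n in sequentially.
        real (card (sym_diff (a <# F n) (F n))) / real (card (F n)) < 1 / real m"
      using m0 by (intro order_tendstoD(2)) auto
  qed
  then have "\<forall>\<^sub>F n in sequentially. \<forall>J\<subseteq>F n. c * real (card (F n)) \<le> real (card J) \<longrightarrow>
      (\<exists>g\<in>T. d * real (card (F n)) \<le> real (card {h\<in>J. g \<otimes> h \<in> J}))"
  proof (rule eventually_mono, intro allI impI)
    fix n J
    let ?f = "real (card (F n))"
    assume inv: "\<forall>a\<in>S. real (card (sym_diff (a <# F n) (F n))) / ?f < 1 / real m"
      and J: "J \<subseteq> F n" "c * ?f \<le> real (card J)"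
    have JG: "J \<subseteq> carrier G" using J(1) folner_subset by blast
    have fJ: "finite J" using J(1) folner_finite finite_subset by blast
    have f0: "0 < ?f" by (rule card_folner_pos)
    have inj: "inj_on ((\<otimes>) a) B" if "a \<in> carrier G" "B \<subseteq> carrier G" for a B
    proof (rule inj_onI)
      fix x y assume "x \<in> B" "y \<in> B" "a \<otimes> x = a \<otimes> y"
      moreover from this have "x \<in> carrier G" "y \<in> carrier G" using that by auto
      ultimately show "x = y" using that by simp
    qed
    have fin_tr: "finite (a <# F n)" for a
      using folner_finite[of n] by (simp add: l_coset_eq_set_mult set_mult_def)
    let ?B = "\<lambda>a. (\<otimes>) a ` J"
    \<comment> \<open>A translate of \<open>J\<close> leaves \<open>F n\<close> only within the
      symmetric difference, which has fewer than \<open>card (F n) / m\<close> elements; the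
      \<open>m\<close> translates together add at most \<open>card (F n)\<close>.\<close>
    have BF: "?B a \<subseteq> F n \<union> sym_diff (a <# F n) (F n)" for a
      using J(1) unfolding l_coset_def by blast
    have "(\<Union>a\<in>S. ?B a) \<subseteq> F n \<union> (\<Union>a\<in>S. sym_diff (a <# F n) (F n))" using BF by blast
    then have "card (\<Union>a\<in>S. ?B a) \<le> card (F n \<union> (\<Union>a\<in>S. sym_diff (a <# F n) (F n)))"
      by (rule card_mono[rotated]) (use S(2) folner_finite fin_tr in auto)
    also have "\<dots> \<le> card (F n) + (\<Sum>a\<in>S. card (sym_diff (a <# F n) (F n)))"
      by (rule order_trans[OF card_Un_le add_left_mono[OF card_UN_le[OF S(2)]]])
    finally have "real (card (\<Union>a\<in>S. ?B a)) \<le> ?f + (\<Sum>a\<in>S. real (card (sym_diff (a <# F n) (F n))))"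
      unfolding of_nat_sum[symmetric] of_nat_add[symmetric] of_nat_le_iff .
    also have "(\<Sum>a\<in>S. real (card (sym_diff (a <# F n) (F n)))) \<le> (\<Sum>a\<in>S. ?f / real m)"
      using inv f0 by (intro sum_mono) (auto simp: pos_divide_less_eq less_imp_le)
    also have "\<dots> = ?f" using S(3) m0 by simp
    finally have upper: "real (card (\<Union>a\<in>S. ?B a)) \<le> 2 * ?f" by simp
    have "\<exists>a\<in>S. \<exists>b\<in>S. a \<noteq> b \<and> d * ?f < real (card (?B a \<inter> ?B b))"
    proof (rule ccontr)
      assume "\<not> ?thesis"
      then have small: "\<And>a b. a \<in> S \<Longrightarrow> b \<in> S \<Longrightarrow> a \<noteq> b \<Longrightarrow> real (card (?B a \<inter> ?B b)) \<le> d * ?f"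
        by (auto simp: not_less)
      have "c * ?f \<le> real (card (?B a))" if "a \<in> S" for a
        using J(2) card_image[OF inj] S(1) JG that by (metis subsetD)
      then have "real (card S) * (c * ?f) - real (card S) ^ 2 * (d * ?f) \<le> real (card (\<Union>a\<in>S. ?B a))"
        using small d f0 fJ by (intro card_UN_ge_of_small_overlaps[OF S(2)]) auto
      moreover have "real (card S) ^ 2 * (d * ?f) = ?f" unfolding d_def S(3) using m0 by simp
      moreover have "4 * ?f \<le> real (card S) * (c * ?f)"
        using mult_right_mono[OF mc, of ?f] f0 unfolding S(3) by (simp add: mult.assoc)
      ultimately show False using upper f0 by linarith
    qed
    then obtain a b where ab: "a \<in> S" "b \<in> S" "a \<noteq> b" "d * ?f < real (card (?B a \<inter> ?B b))" by blast
    have aG: "a \<in> carrier G" and bG: "b \<in> carrier G" using ab S(1) by auto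
    let ?H = "{h\<in>J. (inv b \<otimes> a) \<otimes> h \<in> J}"
    have "?B a \<inter> ?B b \<subseteq> (\<otimes>) a ` ?H"
    proof
      fix y assume "y \<in> ?B a \<inter> ?B b"
      then obtain h h' where h: "h \<in> J" "y = a \<otimes> h" "h' \<in> J" "y = b \<otimes> h'" by blast
      have hG: "h \<in> carrier G" "h' \<in> carrier G" using h JG by auto
      have "(inv b \<otimes> a) \<otimes> h = inv b \<otimes> (b \<otimes> h')" using aG bG hG h by (simp add: m_assoc)
      also have "\<dots> = h'" using bG hG by (simp add: m_assoc[symmetric])
      finally show "y \<in> (\<otimes>) a ` ?H" using h by auto
    qed
    then have "card (?B a \<inter> ?B b) \<le> card ((\<otimes>) a ` ?H)" using fJ by (intro card_mono) auto
    also have "\<dots> \<le> card ?H" using fJ by (intro card_image_le) auto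
    finally have "d * ?f \<le> real (card ?H)" using ab(4) by linarith
    moreover have "inv b \<otimes> a \<in> T" unfolding T_def using ab by blast
    ultimately show "\<exists>g\<in>T. d * ?f \<le> real (card {h\<in>J. g \<otimes> h \<in> J})" by blast
  qed
  then show ?thesis using finT TK d by blast
qed

text \<open>A choice \<sigma> on \<open>J'\<close> prescribes the set
  \<open>A (r (\<sigma> h))\<close> at time \<open>h\<close> and \<open>A (r' (\<sigma> h))\<close>
  at time \<open>g \<otimes> h\<close>. If both times lie in \<open>J\<close> and \<open>J'\<close>
  is disjoint from its translate, these demands never conflict, and the shattering of
  \<open>J\<close> meets them all.\<close>

lemma positive_density_return:
  assumes "positive_density A I" "finite K" "I \<noteq> {}" "r \<in> I' \<rightarrow> I" "r' \<in> I' \<rightarrow> I"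
  shows "\<exists>g\<in>carrier G - K. positive_density (\<lambda>i. {x \<in> A (r i). \<phi> g x \<in> A (r' i)}) I'"
proof -
  obtain c where c: "0 < c" and freq: "\<exists>\<^sub>F n in sequentially. \<exists>J\<subseteq>F n.
      c * real (card (F n)) \<le> real (card J) \<and> shatters X J (\<lambda>g i. {x. \<phi> g x \<in> A i}) I"
    using assms(1) unfolding positive_density_def by blast
  \<comment> \<open>Excluding the identity ensures that left translation by \<open>g\<close> has no
    fixed point.\<close>
  have finK: "finite (insert \<one> K)" using assms(2) by simp
  obtain T d where T: "T \<subseteq> carrier G - insert \<one> K" "finite T" and d: "0 < d"
    and ev: "\<forall>\<^sub>F n in sequentially. \<forall>J\<subseteq>F n. c * real (card (F n)) \<le> real (card J) \<longrightarrow>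
      (\<exists>g\<in>T. d * real (card (F n)) \<le> real (card {h\<in>J. g \<otimes> h \<in> J}))"
    using overlapping_translates[OF c finK] by blast
  let ?A = "\<lambda>g i. {x \<in> A (r i). \<phi> g x \<in> A (r' i)}"
  have "\<exists>\<^sub>F n in sequentially. \<exists>g\<in>T. \<exists>J\<subseteq>F n. (d / 3) * real (card (F n)) \<le> real (card J) \<and>
      shatters X J (\<lambda>h i. {x. \<phi> h x \<in> ?A g i}) I'"
    using frequently_eventually_conj[OF freq ev]
  proof (rule frequently_elim1)
    fix n
    let ?f = "real (card (F n))"
    assume "(\<forall>J\<subseteq>F n. c * ?f \<le> real (card J) \<longrightarrow>
        (\<exists>g\<in>T. d * ?f \<le> real (card {h\<in>J. g \<otimes> h \<in> J}))) \<and>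
      (\<exists>J\<subseteq>F n. c * ?f \<le> real (card J) \<and> shatters X J (\<lambda>g i. {x. \<phi> g x \<in> A i}) I)"
    then obtain J g where J: "J \<subseteq> F n" "shatters X J (\<lambda>g i. {x. \<phi> g x \<in> A i}) I"
      and g: "g \<in> T" "d * ?f \<le> real (card {h\<in>J. g \<otimes> h \<in> J})" by blast
    have gG: "g \<in> carrier G" "g \<noteq> \<one>" using g(1) T(1) by auto
    let ?H = "{h\<in>J. g \<otimes> h \<in> J}"
    have JG: "J \<subseteq> carrier G" using J(1) folner_subset by blast
    have fH: "finite ?H" using finite_subset[OF J(1) folner_finite] by simp
    have injH: "inj_on ((\<otimes>) g) ?H" 
    proof (rule inj_onI)
      fix x y assume "x \<in> ?H" "y \<in> ?H" "g \<otimes> x = g \<otimes> y"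
      moreover from this have "x \<in> carrier G" "y \<in> carrier G" using JG by auto
      ultimately show "x = y" using gG by simp
    qed
    have neH: "\<And>h. h \<in> ?H \<Longrightarrow> g \<otimes> h \<noteq> h"
      using JG gG by (auto simp: subset_iff)
    obtain J' where J': "J' \<subseteq> ?H" "(\<otimes>) g ` J' \<inter> J' = {}" "card ?H \<le> 3 * card J'"
      using displaced_third[OF fH injH neH] by blast
    have "(d / 3) * ?f \<le> real (card J')" using g(2) J'(3) by linarith
    moreover have "J' \<subseteq> F n" using J' J(1) by blast
    moreover have "shatters X J' (\<lambda>h i. {x. \<phi> h x \<in> ?A g i}) I'"
      unfolding shatters_def
    proof
      fix \<sigma> assume \<sigma>: "\<sigma> \<in> J' \<rightarrow> I'"
      obtain i0 where i0: "i0 \<in> I" using assms(3) by blast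
      \<comment> \<open>Off \<open>J'\<close> and its translate nothing is prescribed, so an
        arbitrary letter \<open>i0\<close> fills in.\<close>
      define \<tau> where "\<tau> h = (if h \<in> J' then r (\<sigma> h)
        else if inv g \<otimes> h \<in> J' then r' (\<sigma> (inv g \<otimes> h)) else i0)" for h
      have "\<tau> \<in> J \<rightarrow> I" using i0 assms(4,5) \<sigma> unfolding \<tau>_def
        by (intro funcsetI) (simp add: Pi_iff)
      then obtain x where x: "x \<in> X" "\<forall>h\<in>J. \<phi> h x \<in> A (\<tau> h)"
        using shattersD[OF J(2)] by fastforce
      have "\<phi> h x \<in> ?A g (\<sigma> h)" if h: "h \<in> J'" for h
      proof -
        have hJ: "h \<in> J" "g \<otimes> h \<in> J" using h J'(1) by auto
        have hG: "h \<in> carrier G" using hJ JG by blast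
        have "\<phi> h x \<in> A (\<tau> h)" using x(2) hJ(1) by blast
        moreover have "\<tau> h = r (\<sigma> h)" unfolding \<tau>_def using h by simp
        moreover have "\<phi> g (\<phi> h x) \<in> A (\<tau> (g \<otimes> h))"
          using x hJ(2) composition_rule[OF x(1) gG(1) hG] by metis
        moreover have "g \<otimes> h \<notin> J'" using J'(2) h by blast
        moreover have "inv g \<otimes> (g \<otimes> h) = h" using gG hG by (simp add: m_assoc[symmetric])
        ultimately show ?thesis using h unfolding \<tau>_def by auto
      qed
      then show "\<exists>x\<in>X. \<forall>h\<in>J'. x \<in> {x. \<phi> h x \<in> ?A g (\<sigma> h)}" using x(1) by blast
    qed
    ultimately show "\<exists>g\<in>T. \<exists>J\<subseteq>F n. (d / 3) * ?f \<le> real (card J) \<and>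
        shatters X J (\<lambda>h i. {x. \<phi> h x \<in> ?A g i}) I'" using g(1) by blast
  qed
  \<comment> \<open>Pigeonhole over the finite set \<open>T\<close>: a single \<open>g\<close> works
    for infinitely many \<open>n\<close>.\<close>
  then have "\<exists>g\<in>T. \<exists>\<^sub>F n in sequentially. \<exists>J\<subseteq>F n.
      (d / 3) * real (card (F n)) \<le> real (card J) \<and> shatters X J (\<lambda>h i. {x. \<phi> h x \<in> ?A g i}) I'"
    by (rule frequently_bex_finite[OF T(2)])
  then obtain g where "g \<in> T" "\<exists>\<^sub>F n in sequentially. \<exists>J\<subseteq>F n.
      (d / 3) * real (card (F n)) \<le> real (card J) \<and> shatters X J (\<lambda>h i. {x. \<phi> h x \<in> ?A g i}) I'"
    by blast
  then show ?thesis using T(1) d unfolding positive_density_def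
    by (intro bexI[of _ g] exI[of _ "d / 3"]) auto
qed

end

subsection \<open>Construction of the scrambled set\<close>

lemma eventually_subset_infinity:
  assumes "finite K" "K \<subseteq> A"
  shows "\<forall>\<^sub>F E in finite_subsets_at_top A. finite E \<and> K \<subseteq> E \<and> E \<subseteq> A"
  using assms unfolding eventually_finite_subsets_at_top by blast

text \<open>The suprema decrease as the finite set grows, so the net converges to their infimum
  \<open>L\<close>, which is at least \<delta>. Infinity of the group keeps the index sets
  nonempty.\<close>

lemma limsup_infinity_pos:
  fixes f :: "'g \<Rightarrow> real"
  assumes inf: "infinite (carrier G)" and bound: "\<And>g. g \<in> carrier G \<Longrightarrow> 0 \<le> f g \<and> f g \<le> b"
    and "0 < \<delta>" and far: "\<And>K. finite K \<Longrightarrow> \<exists>g\<in>carrier G - K. \<delta> \<le> f g"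
  shows "limsup_infinity G f > 0"
proof -
  let ?h = "\<lambda>E. SUP g\<in>carrier G - E. f g"
  have bdd: "bdd_above (f ` (carrier G - E))" for E using bound by (intro bdd_aboveI[of _ b]) auto
  have ge: "\<delta> \<le> ?h E" if "finite E" for E
    using far[OF that] bdd[of E] by (meson cSUP_upper2)
  let ?fin = "{E. finite E \<and> E \<subseteq> carrier G}"
  define L where "L = (INF E\<in>?fin. ?h E)"
  have bdd_below: "bdd_below (?h ` ?fin)" using ge by (intro bdd_belowI[of _ \<delta>]) auto
  have "(?h \<longlongrightarrow> L) (finite_subsets_at_top (carrier G))"
  proof (rule order_tendstoI)
    fix a assume "a < L"
    have "L \<le> ?h E" if "finite E" "E \<subseteq> carrier G" for E
      unfolding L_def using bdd_below that by (intro cINF_lower) auto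
    then show "\<forall>\<^sub>F E in finite_subsets_at_top (carrier G). a < ?h E"
      using eventually_subset_infinity[of "{}" "carrier G"] \<open>a < L\<close>
      by (auto elim!: eventually_mono intro: less_le_trans)
  next
    fix a assume "L < a"
    then obtain E where E: "finite E" "E \<subseteq> carrier G" "?h E < a"
      unfolding L_def using bdd_below by (subst (asm) cINF_less_iff) auto
    have "?h E' < a" if "finite E'" "E \<subseteq> E'" for E'
    proof -
      have "carrier G - E' \<noteq> {}" using inf that by (metis Diff_eq_empty_iff finite_subset)
      then have "?h E' \<le> ?h E" using that bdd by (intro cSUP_subset_mono) auto
      then show ?thesis using E(3) by linarith
    qed
    then show "\<forall>\<^sub>F E in finite_subsets_at_top (carrier G). ?h E < a"
      using eventually_subset_infinity[OF E(1,2)] by (auto elim!: eventually_mono)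
  qed
  then have "limsup_infinity G f = L" unfolding limsup_infinity_def
    by (intro tendsto_Lim) auto
  moreover have "\<delta> \<le> L" unfolding L_def using ge by (intro cINF_greatest) auto
  ultimately show ?thesis using assms(3) by linarith
qed

text \<open>Every infimum over the complement of a finite set is exactly 0, so the net is eventually
  constant.\<close>

lemma liminf_infinity_zero:
  fixes f :: "'g \<Rightarrow> real"
  assumes bound: "\<And>g. g \<in> carrier G \<Longrightarrow> 0 \<le> f g"
    and close: "\<And>K e. finite K \<Longrightarrow> 0 < e \<Longrightarrow> \<exists>g\<in>carrier G - K. f g \<le> e"
  shows "liminf_infinity G f = 0"
proof -
  let ?h = "\<lambda>E. INF g\<in>carrier G - E. f g"
  have "?h E = 0" if E: "finite E" for E
  proof (rule antisym)
    have bdd: "bdd_below (f ` (carrier G - E))" using bound by (intro bdd_belowI[of _ 0]) auto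
    show "?h E \<le> 0"
    proof (rule field_le_epsilon)
      fix e :: real assume "0 < e"
      then show "?h E \<le> 0 + e" using close[OF E] bdd by (metis add_0 cINF_lower2)
    qed
    have "carrier G - E \<noteq> {}" using close[OF E, of 1] by auto
    then show "0 \<le> ?h E" using bound by (intro cINF_greatest) auto
  qed
  then have "\<forall>\<^sub>F E in finite_subsets_at_top (carrier G). ?h E = 0"
    using eventually_subset_infinity[of "{}" "carrier G"] by (auto elim!: eventually_mono)
  then have "(?h \<longlongrightarrow> 0) (finite_subsets_at_top (carrier G))" by (rule tendsto_eventually)
  then show ?thesis unfolding liminf_infinity_def by (intro tendsto_Lim) auto
qed

lemma uncountable_bool_sequences: "uncountable (UNIV :: (nat \<Rightarrow> bool) set)"
proof
  assume "countable (UNIV :: (nat \<Rightarrow> bool) set)"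
  then obtain f :: "nat \<Rightarrow> nat \<Rightarrow> bool" where "range f = UNIV"
    using uncountable_def by blast
  then obtain n where "f n = (\<lambda>k. \<not> f k k)" by (metis surjD)
  then show False by metis
qed

text \<open>Closed balls are wanted, so that closed sets stay closed when cut down to a
  ball.\<close>

lemma finite_subcover_cball:
  fixes X :: "'x::metric_space set"
  assumes "compact X" "0 < e"
  shows "\<exists>M\<subseteq>X. finite M \<and> X \<subseteq> (\<Union>m\<in>M. cball m e)"
proof -
  have "X \<subseteq> (\<Union>m\<in>X. ball m e)" using assms(2) by auto
  from compactE_image[OF assms(1) open_ball this]
  obtain M where M: "M \<subseteq> X" "finite M" "X \<subseteq> (\<Union>m\<in>M. ball m e)" .
  have "(\<Union>m\<in>M. ball m e) \<subseteq> (\<Union>m\<in>M. cball m e)" by (intro UN_mono ball_subset_cball order_refl)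
  then show ?thesis using M by (intro exI[of _ M]) auto
qed

lemma separate_compact_sets:
  fixes S T :: "'x::metric_space set"
  assumes "compact S" "compact T" "S \<inter> T = {}"
  shows "\<exists>\<delta>>0. \<forall>y\<in>S. \<forall>z\<in>T. \<delta> \<le> dist y z"
proof (cases "S \<times> T = {}")
  case True
  then show ?thesis by (intro exI[of _ 1]) auto
next
  case False
  have "continuous_on (S \<times> T) (\<lambda>p. dist (fst p) (snd p))" by (intro continuous_intros)
  then obtain p where p: "p \<in> S \<times> T" "\<forall>q\<in>S \<times> T. dist (fst p) (snd p) \<le> dist (fst q) (snd q)"
    using continuous_attains_inf[OF compact_Times[OF assms(1,2)] False] by blast
  have "0 < dist (fst p) (snd p)" using p(1) assms(3) by auto
  then show ?thesis using p(2) by (intro exI[of _ "dist (fst p) (snd p)"]) auto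
qed

section \<open>The Cantor scheme\<close>

text \<open>The shift by one gives level 0 two words, the least number of indices for which density
  and growth are interchangeable.\<close>

definition words :: "nat \<Rightarrow> bool list set" where
  "words n = {s. length s = Suc n}"

lemma finite_words: "finite (words n)"
  using finite_lists_length_eq[of "UNIV :: bool set" "Suc n"] unfolding words_def by simp

lemma card_words: "2 \<le> card (words n)"
proof -
  have "card (words n) = 2 ^ Suc n"
    using card_lists_length_eq[of "UNIV :: bool set" "Suc n"] unfolding words_def by simp
  then show ?thesis by simp
qed

context folner_system
begin

definition scheme_level :: "nat \<Rightarrow> (bool list \<Rightarrow> 'x set) \<Rightarrow> bool" where
  "scheme_level n A \<longleftrightarrow> positive_density A (words n) \<and> disjoint_family_on A (words n) \<and>
     (\<forall>s\<in>words n. closed (A s) \<and> A s \<subseteq> X)"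

text \<open>Each group element is chosen before the words. One returns every new set to its own
  parent, so points with disjoint parents stay apart; another sends all new sets into one small
  ball, so all points come together.\<close>

definition scheme_step :: "nat \<Rightarrow> real \<Rightarrow> 'a set \<Rightarrow> (bool list \<Rightarrow> 'x set) \<Rightarrow> (bool list \<Rightarrow> 'x set) \<Rightarrow> bool" where
  "scheme_step n e K A A' \<longleftrightarrow> (\<forall>s\<in>words (Suc n). A' s \<subseteq> A (butlast s)) \<and>
     (\<exists>g\<in>carrier G - K. \<forall>s\<in>words (Suc n). \<phi> g ` A' s \<subseteq> A (butlast s)) \<and>
     (\<exists>g\<in>carrier G - K. \<exists>y. \<forall>s\<in>words (Suc n). \<phi> g ` A' s \<subseteq> cball y e)"

lemma closed_return:
  assumes "g \<in> carrier G" "closed A" "A \<subseteq> X" "closed B"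
  shows "closed {x \<in> A. \<phi> g x \<in> B}"
proof -
  have "continuous_on A (\<phi> g)" using continuous_action[OF assms(1)] assms(3) by (rule continuous_on_subset)
  then have "closed (A \<inter> \<phi> g -` B)" using assms(2,4) by (intro continuous_closed_preimage)
  then show ?thesis by (simp add: Int_def vimage_def)
qed

text \<open>A level is refined by shrinking one of its sets and then passing three times to returns:
  into the shrunk set (proximality), into the set itself (separation), and into one of two
  disjoint sets according to the last letter (branching).\<close>

lemma scheme_refine:
  assumes lev: "scheme_level n A" and "finite K" "0 < e"
  shows "\<exists>A'. scheme_level (Suc n) A' \<and> scheme_step n e K A A'"
proof -
  let ?I = "words n"
  \<comment> \<open>Two distinct words available at every level: \<open>t True\<close> names the set
    to be shrunk, and the pair encodes the new letter when branching.\<close>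
  define t where "t b = replicate (Suc n) b" for b :: bool
  have t: "t b \<in> ?I" for b unfolding t_def words_def by simp
  have Ine: "?I \<noteq> {}" using t by blast
  have A: "positive_density A ?I" "disjoint_family_on A ?I"
    "\<And>s. s \<in> ?I \<Longrightarrow> closed (A s)" "\<And>s. s \<in> ?I \<Longrightarrow> A s \<subseteq> X"
    using lev unfolding scheme_level_def by auto
  obtain M where M: "finite M" "X \<subseteq> (\<Union>m\<in>M. cball m e)"
    using finite_subcover_cball[OF compact_space assms(3)] by blast
  have "A (t True) \<subseteq> (\<Union>m\<in>M. cball m e)" using A(4)[OF t] M(2) by blast
  from positive_density_split[OF A(1) finite_words card_words A(2) t M(1) this]
  obtain m where dens: "positive_density (A(t True := A (t True) \<inter> cball m e)) ?I" by blast
  define B where "B = A(t True := A (t True) \<inter> cball m e)"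
  have B: "positive_density B ?I" using dens unfolding B_def .
  have BA: "B s \<subseteq> A s" for s unfolding B_def by auto
  have Bt: "B (t True) \<subseteq> cball m e" unfolding B_def by auto
  have Bc: "closed (B s)" if "s \<in> ?I" for s using A(3)[OF that] unfolding B_def by auto
  obtain g where g: "g \<in> carrier G - K"
    "positive_density (\<lambda>s. {x \<in> B s. \<phi> g x \<in> B (t True)}) ?I"
    using positive_density_return[OF B assms(2) Ine, of "\<lambda>s. s" ?I "\<lambda>_. t True"] t by auto
  define C where "C s = {x \<in> B s. \<phi> g x \<in> B (t True)}" for s
  have C: "positive_density C ?I" using g(2) unfolding C_def .
  have Cc: "closed (C s)" "C s \<subseteq> X" if "s \<in> ?I" for s
  proof -
    show "C s \<subseteq> X" using A(4)[OF that] BA[of s] unfolding C_def by auto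
    show "closed (C s)" unfolding C_def
      using g(1) Bc[OF that] Bc[OF t] A(4)[OF that] BA[of s] by (intro closed_return) auto
  qed
  obtain h where h: "h \<in> carrier G - K"
    "positive_density (\<lambda>s. {x \<in> C s. \<phi> h x \<in> C s}) ?I"
    using positive_density_return[OF C assms(2) Ine, of "\<lambda>s. s" ?I "\<lambda>s. s"] by auto
  define D where "D s = {x \<in> C s. \<phi> h x \<in> C s}" for s
  have D: "positive_density D ?I" using h(2) unfolding D_def .
  have Dc: "closed (D s)" "D s \<subseteq> X" if "s \<in> ?I" for s
  proof -
    show "D s \<subseteq> X" using Cc(2)[OF that] unfolding D_def by auto
    show "closed (D s)" unfolding D_def using h(1) Cc[OF that] by (intro closed_return) auto
  qed
  have bl: "butlast s \<in> ?I" if "s \<in> words (Suc n)" for s using that unfolding words_def by simp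
  obtain k where k: "k \<in> carrier G - K"
    "positive_density (\<lambda>s. {x \<in> D (butlast s). \<phi> k x \<in> D (t (last s))}) (words (Suc n))"
    using positive_density_return[OF D assms(2) Ine, of butlast "words (Suc n)" "\<lambda>s. t (last s)"] bl t
    by auto
  define E where "E s = {x \<in> D (butlast s). \<phi> k x \<in> D (t (last s))}" for s
  have DA: "D s \<subseteq> A s" for s using BA[of s] unfolding D_def C_def by auto
  have disj: "A s \<inter> A s' = {}" if "s \<in> ?I" "s' \<in> ?I" "s \<noteq> s'" for s s'
    using A(2) that unfolding disjoint_family_on_def by blast
  have "scheme_level (Suc n) E"
    unfolding scheme_level_def
  proof (intro conjI ballI)
    show "positive_density E (words (Suc n))" using k(2) unfolding E_def .
    show "disjoint_family_on E (words (Suc n))"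
      unfolding disjoint_family_on_def
    proof (intro ballI impI)
      fix s s' assume s: "s \<in> words (Suc n)" "s' \<in> words (Suc n)" "s \<noteq> s'"
      then have "s \<noteq> []" "s' \<noteq> []" unfolding words_def by auto
      \<comment> \<open>Words with different parents inherit disjointness; siblings are told apart
        by where \<open>\<phi> k\<close> sends their sets.\<close>
      then have "butlast s \<noteq> butlast s' \<or> last s \<noteq> last s'"
        using s(3) append_butlast_last_id[of s] append_butlast_last_id[of s'] by fastforce
      then show "E s \<inter> E s' = {}"
      proof
        assume "butlast s \<noteq> butlast s'"
        then show ?thesis using disj[OF bl[OF s(1)] bl[OF s(2)]] DA unfolding E_def by blast
      next
        assume "last s \<noteq> last s'"
        then have "t (last s) \<noteq> t (last s')" unfolding t_def by simp
        then show ?thesis using disj[OF t t] DA unfolding E_def by blast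
      qed
    qed
    fix s assume "s \<in> words (Suc n)"
    then have s: "butlast s \<in> ?I" by (rule bl)
    show "E s \<subseteq> X" using Dc(2)[OF s] unfolding E_def by auto
    show "closed (E s)" unfolding E_def
      using k(1) Dc[OF s] Dc(1)[OF t] by (intro closed_return) auto
  qed
  moreover have "scheme_step n e K A E"
    unfolding scheme_step_def
  proof (intro conjI)
    show "\<forall>s\<in>words (Suc n). E s \<subseteq> A (butlast s)" using DA unfolding E_def by blast
    have "C s \<subseteq> A s" for s using BA unfolding C_def by blast
    then have "\<phi> h ` E s \<subseteq> A (butlast s)" for s unfolding E_def D_def by blast
    then show "\<exists>g\<in>carrier G - K. \<forall>s\<in>words (Suc n). \<phi> g ` E s \<subseteq> A (butlast s)"
      using h(1) by blast
    have "\<phi> g ` E s \<subseteq> cball m e" for s using Bt unfolding E_def D_def C_def by blast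
    then show "\<exists>g\<in>carrier G - K. \<exists>y. \<forall>s\<in>words (Suc n). \<phi> g ` E s \<subseteq> cball y e"
      using g(1) by blast
  qed
  ultimately show ?thesis by blast
qed

text \<open>Every 0-1 sequence selects a decreasing chain of nonempty closed subsets of the compact
  space. Picking a point from each intersection gives an injective image of the Cantor set, which is
  the scrambled set.\<close>

lemma li_yorke_chaotic_of_pair:
  assumes dens: "positive_density A (UNIV :: bool set)"
    and A: "\<And>b. closed (A b)" "\<And>b. A b \<subseteq> X" "A True \<inter> A False = {}"
  shows "li_yorke_chaotic G X \<phi>"
proof -
  \<comment> \<open>Enumerating the group makes the finite sets \<open>K n\<close> exhaust it, so an
    element outside \<open>K n\<close> avoids any given finite set once \<open>n\<close> is
    large.\<close>
  define \<kappa> where "\<kappa> = from_nat_into (carrier G)"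
  have \<kappa>: "range \<kappa> = carrier G"
    unfolding \<kappa>_def by (rule range_from_nat_into) (use countable_group in auto)
  define K where "K n = \<kappa> ` {..n}" for n :: nat
  have K_cover: "\<exists>N. \<forall>n\<ge>N. E \<inter> carrier G \<subseteq> K n" if E: "finite E" for E
  proof -
    have "E \<inter> carrier G \<subseteq> range \<kappa>" using \<kappa> by auto
    then obtain P where P: "finite P" "E \<inter> carrier G = \<kappa> ` P"
      using E by (meson finite_Int finite_subset_image)
    obtain N where "\<forall>p\<in>P. p \<le> N" using P(1) finite_nat_set_iff_bounded_le by blast
    then show ?thesis using P(2) unfolding K_def by (intro exI[of _ N]) (auto intro!: imageI)
  qed
  have "\<exists>f. \<forall>n. scheme_level n (f n) \<and> scheme_step n (1 / real (Suc n)) (K n) (f n) (f (Suc n))"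
  proof (rule dependent_nat_choice)
    have "positive_density (\<lambda>s. A (hd s)) (words 0)"
      by (rule positive_density_reindex[OF dens, of hd]) auto
    moreover have "disjoint_family_on (\<lambda>s. A (hd s)) (words 0)"
      unfolding disjoint_family_on_def
    proof (intro ballI impI)
      fix s s' :: "bool list" assume "s \<in> words 0" "s' \<in> words 0" "s \<noteq> s'"
      then have "hd s \<noteq> hd s'" unfolding words_def by (auto simp: length_Suc_conv)
      then have "{hd s, hd s'} = {True, False}" by (cases "hd s"; cases "hd s'") auto
      then show "A (hd s) \<inter> A (hd s') = {}" using A(3) by (auto simp: doubleton_eq_iff)
    qed
    ultimately have "scheme_level 0 (\<lambda>s. A (hd s))" using A(1,2) unfolding scheme_level_def by blast
    then show "\<exists>x. scheme_level 0 x" by blast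
    fix B n assume "scheme_level n B"
    then show "\<exists>B'. scheme_level (Suc n) B' \<and> scheme_step n (1 / real (Suc n)) (K n) B B'"
      by (rule scheme_refine) (auto simp: K_def)
  qed
  then obtain f where lev: "\<And>n. scheme_level n (f n)"
    and step: "\<And>n. scheme_step n (1 / real (Suc n)) (K n) (f n) (f (Suc n))" by blast
  define w where "w \<sigma> n = map \<sigma> [0..<Suc n]" for \<sigma> :: "nat \<Rightarrow> bool" and n
  have w: "w \<sigma> n \<in> words n" "butlast (w \<sigma> (Suc n)) = w \<sigma> n" for \<sigma> n
    unfolding w_def words_def by (auto simp: butlast_append)
  have dec1: "f (Suc n) (w \<sigma> (Suc n)) \<subseteq> f n (w \<sigma> n)" for \<sigma> n
    using step[of n] w unfolding scheme_step_def by metis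
  have dec: "f n (w \<sigma> n) \<subseteq> f m (w \<sigma> m)" if "m \<le> n" for \<sigma> m n
    using lift_Suc_antimono_le[of "\<lambda>n. f n (w \<sigma> n)", OF dec1 that] .
  have fX: "closed (f n (w \<sigma> n))" "f n (w \<sigma> n) \<subseteq> X" for \<sigma> n
    using lev[of n] w unfolding scheme_level_def by auto
  have fne: "f n (w \<sigma> n) \<noteq> {}" for \<sigma> n
    using positive_density_nonempty[of "f n" "words n" "w \<sigma> n"] lev[of n] w
    unfolding scheme_level_def by blast
  have "\<exists>x. \<forall>n. x \<in> f n (w \<sigma> n)" for \<sigma>
  proof -
    have "X \<inter> (\<Inter>n\<in>UNIV. f n (w \<sigma> n)) \<noteq> {}"
    proof (rule compact_imp_fip_image[OF compact_space])
      show "\<And>n. n \<in> UNIV \<Longrightarrow> closed (f n (w \<sigma> n))" using fX by blast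
      fix P :: "nat set" assume P: "finite P" "P \<subseteq> UNIV"
      obtain N where "\<forall>p\<in>P. p \<le> N" using P(1) finite_nat_set_iff_bounded_le by blast
      then have "f N (w \<sigma> N) \<subseteq> X \<inter> (\<Inter>n\<in>P. f n (w \<sigma> n))" using dec fX by blast
      then show "X \<inter> (\<Inter>n\<in>P. f n (w \<sigma> n)) \<noteq> {}" using fne by blast
    qed
    then show ?thesis by blast
  qed
  then obtain x where x: "\<And>\<sigma> n. x \<sigma> \<in> f n (w \<sigma> n)" by metis
  have xX: "x \<sigma> \<in> X" for \<sigma> using x fX by blast
  have disj: "f n (w \<sigma> n) \<inter> f n (w \<tau> n) = {}" if "\<sigma> n \<noteq> \<tau> n" for \<sigma> \<tau> n
  proof -
    have "w \<sigma> n \<noteq> w \<tau> n" using that unfolding w_def by auto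
    then show ?thesis using lev[of n] w unfolding scheme_level_def disjoint_family_on_def by blast
  qed
  have inj: "inj x"
  proof (rule injI, rule ccontr)
    fix \<sigma> \<tau> assume "x \<sigma> = x \<tau>" "\<sigma> \<noteq> \<tau>"
    then obtain n where "\<sigma> n \<noteq> \<tau> n" by blast
    then show False using disj x \<open>x \<sigma> = x \<tau>\<close> by (metis IntI empty_iff)
  qed
  have pair: "li_yorke_pair G \<phi> (x \<sigma>) (x \<tau>)" if ne: "\<sigma> \<noteq> \<tau>" for \<sigma> \<tau>
    unfolding li_yorke_pair_def
  proof
    let ?d = "\<lambda>g. dist (\<phi> g (x \<sigma>)) (\<phi> g (x \<tau>))"
    \<comment> \<open>At level \<open>n0\<close> the two points lie in disjoint compact sets; the
      distance \<delta> between these bounds all later returns, since the sets decrease.\<close>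
    obtain n0 where n0: "\<sigma> n0 \<noteq> \<tau> n0" using ne by blast
    have cpt: "compact (f n0 (w \<rho> n0))" for \<rho>
      using compact_Int_closed[OF compact_space fX(1)[of n0 \<rho>]] fX(2)[of n0 \<rho>] by (simp add: Int_absorb1)
    have "f n0 (w \<sigma> n0) \<inter> f n0 (w \<tau> n0) = {}" using n0 by (rule disj)
    then obtain \<delta> where \<delta>: "0 < \<delta>" "\<And>y z. y \<in> f n0 (w \<sigma> n0) \<Longrightarrow> z \<in> f n0 (w \<tau> n0) \<Longrightarrow> \<delta> \<le> dist y z"
      using separate_compact_sets[OF cpt[of \<sigma>] cpt[of \<tau>]] by blast
    have bounded: "bounded X" by (rule compact_imp_bounded[OF compact_space])
    show "limsup_infinity G ?d > 0"
    proof (rule limsup_infinity_pos[OF infinite_group _ \<delta>(1)])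
      show "0 \<le> ?d g \<and> ?d g \<le> diameter X" if "g \<in> carrier G" for g
        using diameter_bounded_bound[OF bounded] action_in_space[OF that] xX by auto
      fix E :: "'a set" assume "finite E"
      then obtain N where N: "\<forall>n\<ge>N. E \<inter> carrier G \<subseteq> K n" using K_cover by blast
      \<comment> \<open>Late enough both to avoid \<open>E\<close> and to return into the sets of
        level \<open>n0\<close>.\<close>
      define n where "n = max N n0"
      obtain g where g: "g \<in> carrier G - K n" "\<forall>s\<in>words (Suc n). \<phi> g ` f (Suc n) s \<subseteq> f n (butlast s)"
        using step[of n] unfolding scheme_step_def by blast
      have "\<phi> g (x \<rho>) \<in> f n0 (w \<rho> n0)" for \<rho>
      proof -
        have "\<phi> g (x \<rho>) \<in> f n (w \<rho> n)" using g(2) w x by (metis image_subset_iff)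
        then show ?thesis using dec[of n0 n \<rho>] unfolding n_def by auto
      qed
      then have "\<delta> \<le> ?d g" by (intro \<delta>(2))
      moreover have "g \<in> carrier G - E" using g(1) N[rule_format, of n] unfolding n_def by auto
      ultimately show "\<exists>g\<in>carrier G - E. \<delta> \<le> ?d g" by blast
    qed
    show "liminf_infinity G ?d = 0"
    proof (rule liminf_infinity_zero)
      fix E :: "'a set" and e :: real assume E: "finite E" and e: "0 < e"
      then obtain N where N: "\<forall>n\<ge>N. E \<inter> carrier G \<subseteq> K n" using K_cover by blast
      \<comment> \<open>Half of \<open>e\<close>, as each of the two points is only brought close to
        a common centre.\<close>
      obtain N' where N': "1 / real (Suc N') < e / 2" using nat_approx_posE e by (metis half_gt_zero)
      define n where "n = max N N'"
      have "1 / real (Suc n) \<le> 1 / real (Suc N')" unfolding n_def by (intro divide_left_mono) auto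
      then have small: "1 / real (Suc n) < e / 2" using N' by linarith
      obtain g y where g: "g \<in> carrier G - K n" "\<forall>s\<in>words (Suc n). \<phi> g ` f (Suc n) s \<subseteq> cball y (1 / real (Suc n))"
        using step[of n] unfolding scheme_step_def by blast
      have "dist y (\<phi> g (x \<rho>)) \<le> 1 / real (Suc n)" for \<rho>
        using g(2) w(1) x by (metis image_subset_iff mem_cball)
      then have "?d g \<le> e" using small dist_triangle3[of "\<phi> g (x \<sigma>)" "\<phi> g (x \<tau>)" y]
        by (smt (verit) field_sum_of_halves)
      moreover have "g \<in> carrier G - E" using g(1) N[rule_format, of n] unfolding n_def by auto
      ultimately show "\<exists>g\<in>carrier G - E. ?d g \<le> e" by blast
    qed simp
  qed
  have "uncountable (range x)"
    using uncountable_bool_sequences inj countable_image_inj_eq by blast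
  then show ?thesis unfolding li_yorke_chaotic_def
  proof (intro exI[of _ "range x"] conjI ballI impI)
    fix y z assume "y \<in> range x" "z \<in> range x" "y \<noteq> z"
    then obtain \<sigma> \<tau> where "y = x \<sigma>" "z = x \<tau>" "\<sigma> \<noteq> \<tau>" by blast
    then show "li_yorke_pair G \<phi> y z" using pair by simp
  qed (use xX in auto)
qed

section \<open>From positive entropy to a pair of positive density\<close>

text \<open>The sets cut out by the patterns form a subcover of the join; different patterns may cut
  out the same set, so its size is only bounded by their number.\<close>

lemma min_subcover_card_le:
  assumes "pattern_cover X E (\<lambda>g U. {x. \<phi> g x \<in> U}) \<U> k"
  shows "min_subcover_card (cover_join X \<phi> \<U> E) X \<le> k"
proof -
  obtain \<Phi> where \<Phi>: "finite \<Phi>" "card \<Phi> \<le> k" "\<Phi> \<subseteq> E \<rightarrow> \<U>"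
    "\<forall>y\<in>X. \<exists>p\<in>\<Phi>. \<forall>g\<in>E. y \<in> {x. \<phi> g x \<in> p g}"
    using assms unfolding pattern_cover_def by metis
  let ?W = "(\<lambda>s. {x \<in> X. \<forall>g\<in>E. \<phi> g x \<in> s g}) ` \<Phi>"
  have "?W \<subseteq> cover_join X \<phi> \<U> E" using \<Phi>(3) unfolding cover_join_def by blast
  moreover have "X \<subseteq> \<Union>?W" using \<Phi>(4) by fastforce
  ultimately have "min_subcover_card (cover_join X \<phi> \<U> E) X \<le> card ?W"
    unfolding min_subcover_card_def using \<Phi>(1) by (intro Least_le) blast
  also have "\<dots> \<le> k" using card_image_le[OF \<Phi>(1)] \<Phi>(2) by (meson le_trans)
  finally show ?thesis .
qed

text \<open>If the limit did not exist, \<open>lim\<close> would be an unspecified real.  No convergence theorem is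
  needed, though: the sequence is nonnegative, so if its upper limit were \<open>0\<close> it would converge
  to \<open>0\<close>.\<close>

lemma entropy_pos_imp_exponential_growth:
  assumes "topological_entropy X \<phi> F > 0"
  shows "\<exists>\<U>. finite_open_cover X \<U> \<and> exponential_growth (\<lambda>U. U) \<U>"
proof -
  let ?N = "\<lambda>\<U> n. min_subcover_card (cover_join X \<phi> \<U> (F n)) X"
  let ?a = "\<lambda>\<U> n. ln (real (?N \<U> n)) / real (card (F n))"
  obtain \<U> where U: "finite_open_cover X \<U>" "0 < lim (?a \<U>)"
    using assms unfolding topological_entropy_def by (auto simp: less_SUP_iff)
  \<comment> \<open>The subcover number is 0 for empty \<open>X\<close>; the convention
    \<open>ln 0 = 0\<close> covers that case.\<close>
  have nonneg: "0 \<le> ?a \<U> n" for n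
    by (cases "?N \<U> n = 0") (auto intro!: divide_nonneg_nonneg ln_ge_zero)
  have "\<exists>c>0. \<exists>\<^sub>F n in sequentially. c \<le> ?a \<U> n"
  proof (rule ccontr)
    assume "\<not> ?thesis"
    then have small: "\<And>c. 0 < c \<Longrightarrow> \<forall>\<^sub>F n in sequentially. ?a \<U> n < c"
      by (auto simp: not_frequently not_le)
    have "?a \<U> \<longlonglongrightarrow> 0"
    proof (rule order_tendstoI)
      show "\<forall>\<^sub>F n in sequentially. a < ?a \<U> n" if "a < 0" for a
        using nonneg that by (intro always_eventually) (auto intro: less_le_trans)
    qed (rule small)
    then have "lim (?a \<U>) = 0" by (rule limI)
    then show False using U(2) by simp
  qed
  then obtain c where c: "0 < c" "\<exists>\<^sub>F n in sequentially. c \<le> ?a \<U> n" by blast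
  have "\<exists>\<^sub>F n in sequentially. \<forall>k. pattern_cover X (F n) (\<lambda>g U. {x. \<phi> g x \<in> U}) \<U> k \<longrightarrow>
      exp (c * real (card (F n))) \<le> real k"
    using c(2)
  proof (rule frequently_elim1, intro allI impI)
    fix n k assume le: "c \<le> ?a \<U> n" and cov: "pattern_cover X (F n) (\<lambda>g U. {x. \<phi> g x \<in> U}) \<U> k"
    have "c * real (card (F n)) \<le> ln (real (?N \<U> n))"
      using le card_folner_pos[of n] by (simp add: pos_le_divide_eq)
    moreover have "0 < c * real (card (F n))" using c(1) card_folner_pos by simp
    ultimately have "0 < real (?N \<U> n)" and "exp (c * real (card (F n))) \<le> exp (ln (real (?N \<U> n)))"
      by (auto intro!: gr0I)
    then have "exp (c * real (card (F n))) \<le> real (?N \<U> n)" by simp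
    also have "\<dots> \<le> real k" by (rule of_nat_mono[OF min_subcover_card_le[OF cov]])
    finally show "exp (c * real (card (F n))) \<le> real k" .
  qed
  then show ?thesis unfolding exponential_growth_def using U(1) c(1) by blast
qed

text \<open>With a Lebesgue number \<open>e\<close> of the cover and a finite net \<open>M\<close>
  of mesh \<open>e / 2\<close>, pair each closed \<open>e / 2\<close>-ball with the complement of
  the \<open>e\<close>-ball. A point avoiding some \<open>A m False\<close> lies in an
  \<open>e\<close>-ball inside a member of the cover, and no point of \<open>X\<close> avoids every
  \<open>A m True\<close>. So the join of these complement covers refines the given one, and one
  pair inherits its growth.\<close>

lemma exponential_growth_imp_dense_pair:
  assumes "finite_open_cover X \<U>" and growth: "exponential_growth (\<lambda>U. U) \<U>"
  shows "\<exists>A. positive_density A (UNIV :: bool set) \<and>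
    (\<forall>b. closed (A b) \<and> A b \<subseteq> X) \<and> A True \<inter> A False = {}"
proof -
  have "\<forall>U\<in>\<U>. \<exists>T. open T \<and> U = X \<inter> T"
    using assms(1) unfolding finite_open_cover_def openin_open by blast
  then obtain T where T: "\<And>U. U \<in> \<U> \<Longrightarrow> open (T U)" "\<And>U. U \<in> \<U> \<Longrightarrow> U = X \<inter> T U" by metis
  have "X \<subseteq> \<Union>(T ` \<U>)" using assms(1) T(2) unfolding finite_open_cover_def by blast
  then obtain e where e: "0 < e" "\<And>x. x \<in> X \<Longrightarrow> \<exists>V\<in>T ` \<U>. ball x e \<subseteq> V"
    using Heine_Borel_lemma[OF compact_space, of "T ` \<U>"] T(1) by blast
  obtain M where M: "M \<subseteq> X" "finite M" "X \<subseteq> (\<Union>m\<in>M. cball m (e / 2))"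
    using finite_subcover_cball[OF compact_space, of "e / 2"] e(1) by auto
  define A where "A m b = (if b then X \<inter> cball m (e / 2) else X - ball m e)" for m b
  have Acl: "closed (A m b)" "A m b \<subseteq> X" for m b
    using compact_imp_closed[OF compact_space] unfolding A_def
    by (auto intro: closed_Int closed_Diff)
  have Adisj: "A m True \<inter> A m False = {}" for m using e(1) unfolding A_def by auto
  have "\<exists>m\<in>M. exponential_growth (\<lambda>b. - A m b) (UNIV :: bool set)"
  proof (rule exponential_growth_join[OF growth M(2)])
    fix f :: "'x \<Rightarrow> bool"
    show "\<exists>U\<in>\<U>. X \<inter> (\<Inter>m\<in>M. - A m (f m)) \<subseteq> U"
    proof (cases "\<exists>m\<in>M. \<not> f m")
      case True
      then obtain m where m: "m \<in> M" "\<not> f m" by blast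
      then obtain U where U: "U \<in> \<U>" "ball m e \<subseteq> T U" using e(2) M(1) by blast
      have "X \<inter> - A m (f m) \<subseteq> U" using m(2) U T(2)[OF U(1)] unfolding A_def by auto
      then show ?thesis using U(1) m(1) by blast
    next
      case False
      then have empty: "X \<inter> (\<Inter>m\<in>M. - A m (f m)) = {}" using M(3) unfolding A_def by auto
      \<comment> \<open>Even an empty intersection must be placed in some member of
        \<open>\<U>\<close>. An empty \<open>X\<close> would be covered by 0 patterns, against
        exponential growth.\<close>
      have "X \<noteq> {}"
      proof
        assume X: "X = {}"
        obtain c where "\<exists>\<^sub>F n in sequentially. \<forall>k. pattern_cover X (F n) (\<lambda>g U. {x. \<phi> g x \<in> U}) \<U> k \<longrightarrow>
            exp (c * real (card (F n))) \<le> real k"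
          using growth unfolding exponential_growth_def by blast
        from frequently_ex[OF this] obtain n where
          "\<forall>k. pattern_cover X (F n) (\<lambda>g U. {x. \<phi> g x \<in> U}) \<U> k \<longrightarrow>
            exp (c * real (card (F n))) \<le> real k" ..
        then have "exp (c * real (card (F n))) \<le> real 0"
          unfolding X using pattern_cover_empty by blast
        then show False by simp
      qed
      then have "\<U> \<noteq> {}" using assms(1) unfolding finite_open_cover_def by auto
      then show ?thesis using empty by blast
    qed
  qed
  then obtain m where m: "exponential_growth (\<lambda>b. - A m b) (UNIV :: bool set)" by blast
  have "disjoint_family_on (A m) UNIV"
    using Adisj[of m] unfolding disjoint_family_on_def by (auto simp: bool.split_sel) (metis (full_types) Int_iff empty_iff)
  then have "positive_density (A m) UNIV"
    using exponential_growth_imp_positive_density[OF _ _ _ m] by simp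
  then show ?thesis using Acl Adisj by blast
qed

end

theorem corollary1p3:
  fixes G :: "('g, 'm) monoid_scheme"
    and X :: "'x::metric_space set"
    and \<phi> :: "'g \<Rightarrow> 'x \<Rightarrow> 'x"
    and F :: "nat \<Rightarrow> 'g set"
  assumes "group G" and "infinite (carrier G)" and "countable (carrier G)" and "amenable G"
    and "G_system G X \<phi>"
    and "folner_sequence G F"
    and "topological_entropy X \<phi> F > 0"
  shows "li_yorke_chaotic G X \<phi>"
proof -
  interpret folner_system G X \<phi> F
    using assms(2,5,6) by (simp add: folner_system_def folner_system_axioms_def)
  obtain \<U> where "finite_open_cover X \<U>" "exponential_growth (\<lambda>U. U) \<U>"
    using entropy_pos_imp_exponential_growth[OF assms(7)] by blast
  then obtain A where "positive_density A (UNIV :: bool set)"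
    "\<forall>b. closed (A b) \<and> A b \<subseteq> X" "A True \<inter> A False = {}"
    using exponential_growth_imp_dense_pair by blast
  then show ?thesis using li_yorke_chaotic_of_pair by blast
qed

end
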